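(* The functions $p\mapsto L(p)$ and $p\mapsto K(p)$ are infinitely differentiable on the interval $p\in(4,\infty)$.
   Context: For $p\ge4$: $L(p)=\mathbf{E}|\vartheta-1|^p=e^{-1}\sum_{n=0}^\infty\frac{|n-1|^p}{n!}$, where $\vartheta$ is Poisson distributed with parameter $1$. For a random variable $\xi$, $\|\xi\|_p=(\mathbf{E}|\xi|^p)^{1/p}$. For $p\ge2$, $$S(p)=\sup_{\{\xi(i)\}}\sup_n\frac{\|\sum_{i=1}^n\xi(i)\|_p}{\max\left(\|\sum_{i=1}^n\xi(i)\|_2,\ \left(\sum_{i=1}^n\|\xi(i)\|_p^p\right)^{1/p}\right)},$$ where the outer supremum is over all sequences of independent, symmetrically distributed real random variables with $\|\xi(i)\|_p<\infty$ for all $i$ (with nonzero denominator), and $K(p)=S(p)^p$. *)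

theory Defs
  imports "HOL-Probability.Probability"
begin

definition poisson_L :: "real \<Rightarrow> real" where
  "poisson_L p = measure_pmf.expectation (poisson_pmf 1) (\<lambda>n. \<bar>real n - 1\<bar> powr p)"

lemma poisson_L_series:
  assumes "p > 0"
  shows "summable (\<lambda>n. \<bar>real n - 1\<bar> powr p / fact n)"
    and "poisson_L p = exp (- 1) * (\<Sum>n. \<bar>real n - 1\<bar> powr p / fact n)"
proof -
  define k where "k = nat \<lceil>p\<rceil>"
  have "summable (\<lambda>n. exp (real k) ^ n /\<^sub>R fact n)"
    by (rule summable_exp_generic)
  then have exp_summable: "summable (\<lambda>n. fact k * (exp (real k) ^ n / fact n))"
    by (intro summable_mult) (simp add: field_simps)
  have bound: "\<bar>real n - 1\<bar> powr p \<le> fact k * exp (real k) ^ n" for n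
  proof (cases "n \<le> 1")
    case True
    then have "\<bar>real n - 1\<bar> powr p \<le> 1"
      by (cases n) auto
    also have "1 \<le> fact k * exp (real k) ^ n"
    proof -
      have "1 \<le> exp (real k) ^ n" by (simp add: one_le_power)
      moreover have "(1::real) \<le> fact k" by (rule fact_ge_1)
      ultimately show ?thesis using mult_mono[of 1 "fact k" 1 "exp (real k) ^ n"] by simp
    qed
    finally show ?thesis .
  next
    case False
    have "\<bar>real n - 1\<bar> powr p \<le> real n powr p"
      using False assms by (intro powr_mono2) auto
    also have "\<dots> \<le> real n powr real k"
      using False assms by (intro powr_mono) (auto simp: k_def)
    also have "\<dots> = real n ^ k"
      using False by (simp add: powr_realpow)
    also have "\<dots> \<le> exp (real n) ^ k"
      using exp_ge_add_one_self[of "real n"] by (intro power_mono) linarith+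
    also have "\<dots> = exp (real k) ^ n"
      by (simp add: exp_of_nat_mult[symmetric] mult.commute)
    also have "\<dots> \<le> fact k * exp (real k) ^ n"
      using mult_right_mono[OF fact_ge_1[of k], of "exp (real k) ^ n"] by simp
    finally show ?thesis .
  qed
  show summable: "summable (\<lambda>n. \<bar>real n - 1\<bar> powr p / fact n)"
    by (rule summable_comparison_test'[OF exp_summable, of 0])
       (use bound in \<open>auto simp: divide_right_mono\<close>)
  have "poisson_L p =
      (\<integral>n. exp (- 1) * (\<bar>real n - 1\<bar> powr p / fact n) \<partial>count_space UNIV)"
    unfolding poisson_L_def measure_pmf_eq_density
    by (subst integral_density) (auto intro!: Bochner_Integration.integral_cong simp: field_simps)
  also have "\<dots> = (\<Sum>n. exp (- 1) * (\<bar>real n - 1\<bar> powr p / fact n))"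
    by (intro integral_count_space_nat)
       (use summable_mult[OF summable, of "exp (- 1)"]
        in \<open>simp add: integrable_count_space_nat_iff\<close>)
  also have "\<dots> = exp (- 1) * (\<Sum>n. \<bar>real n - 1\<bar> powr p / fact n)"
    by (rule suminf_mult[OF summable])
  finally show "poisson_L p = exp (- 1) * (\<Sum>n. \<bar>real n - 1\<bar> powr p / fact n)" .
qed

definition Lp_norm :: "'a measure \<Rightarrow> real \<Rightarrow> ('a \<Rightarrow> real) \<Rightarrow> real" where
  "Lp_norm M p X = (\<integral>\<omega>. \<bar>X \<omega>\<bar> powr p \<partial>M) powr (1 / p)"

definition symmetrically_distributed :: "'a measure \<Rightarrow> ('a \<Rightarrow> real) \<Rightarrow> bool" where
  "symmetrically_distributed M X \<longleftrightarrow> distr M borel X = distr M borel (\<lambda>\<omega>. - X \<omega>)"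

definition admissible_sequence :: "real \<Rightarrow> 'a measure \<Rightarrow> (nat \<Rightarrow> 'a \<Rightarrow> real) \<Rightarrow> bool" where
  "admissible_sequence p M X \<longleftrightarrow>
     prob_space M \<and>
     prob_space.indep_vars M (\<lambda>_. borel) X UNIV \<and>
     (\<forall>i. symmetrically_distributed M (X i)) \<and>
     (\<forall>i. integrable M (\<lambda>\<omega>. \<bar>X i \<omega>\<bar> powr p))"

definition rosenthal_denom :: "real \<Rightarrow> 'a measure \<Rightarrow> (nat \<Rightarrow> 'a \<Rightarrow> real) \<Rightarrow> nat \<Rightarrow> real" where
  "rosenthal_denom p M X n =
     max (Lp_norm M 2 (\<lambda>\<omega>. \<Sum>i<n. X i \<omega>))
         ((\<Sum>i<n. Lp_norm M p (X i) powr p) powr (1 / p))"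

definition rosenthal_ratio :: "real \<Rightarrow> 'a measure \<Rightarrow> (nat \<Rightarrow> 'a \<Rightarrow> real) \<Rightarrow> nat \<Rightarrow> real" where
  "rosenthal_ratio p M X n = Lp_norm M p (\<lambda>\<omega>. \<Sum>i<n. X i \<omega>) / rosenthal_denom p M X n"

text \<open>
  A supremum cannot range over probability spaces of all types, so the sample space is taken to
  have type \<^typ>\<open>nat \<Rightarrow> real\<close> (with an arbitrary sigma-algebra and probability measure). This is
  no restriction: see \<open>rosenthal_ratio_in_set\<close> below.
\<close>

definition rosenthal_ratios :: "real \<Rightarrow> real set" where
  "rosenthal_ratios p =
     {rosenthal_ratio p M X n | (M :: (nat \<Rightarrow> real) measure) X n.
        admissible_sequence p M X \<and> rosenthal_denom p M X n \<noteq> 0}"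

lemma rosenthal_ratio_in_set:
  fixes M :: "'a measure"
  assumes adm: "admissible_sequence p M X" and denom: "rosenthal_denom p M X n \<noteq> 0"
  shows "rosenthal_ratio p M X n \<in> rosenthal_ratios p"
proof -
  interpret prob_space M
    using adm by (simp add: admissible_sequence_def)
  define P where "P = (\<Pi>\<^sub>M i\<in>(UNIV :: nat set). (borel :: real measure))"
  define T where "T = (\<lambda>\<omega> i. X i \<omega>)"
  define N where "N = distr M P T"
  define Y where "Y = (\<lambda>i (w :: nat \<Rightarrow> real). w i)"
  have indep: "indep_vars (\<lambda>_. borel) X UNIV"
    using adm by (simp add: admissible_sequence_def)
  then have rv [measurable]: "random_variable borel (X i)" for i
    by (auto simp: indep_vars_def)
  have T [measurable]: "T \<in> M \<rightarrow>\<^sub>M P"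
    unfolding T_def P_def by (rule measurable_PiM_single') (auto simp: space_PiM)
  have coord [measurable]: "(\<lambda>w. w i) \<in> P \<rightarrow>\<^sub>M borel" for i
    unfolding P_def by (rule measurable_component_singleton) simp
  then have Y [measurable]: "Y i \<in> P \<rightarrow>\<^sub>M borel" for i
    unfolding Y_def .
  interpret N: prob_space N
    unfolding N_def by (rule prob_space_distr[OF T])
  have Y' [measurable]: "Y i \<in> N \<rightarrow>\<^sub>M borel" for i
    unfolding N_def by simp
  have distr_Y: "distr N borel (Y i) = distr M borel (X i)" for i
    unfolding N_def by (subst distr_distr[OF Y T]) (simp add: comp_def T_def Y_def)
  have distr_mY: "distr N borel (\<lambda>w. - Y i w) = distr M borel (\<lambda>\<omega>. - X i \<omega>)" for i
    unfolding N_def by (subst distr_distr[OF _ T]) (simp_all add: comp_def T_def Y_def)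
  have "(\<lambda>w. \<lambda>i\<in>UNIV. Y i w) \<in> P \<rightarrow>\<^sub>M P"
    by (simp add: Y_def restrict_def)
  then have "distr N P (\<lambda>w. \<lambda>i\<in>UNIV. Y i w) = distr M P (\<lambda>\<omega>. \<lambda>i\<in>UNIV. X i \<omega>)"
    unfolding N_def by (subst distr_distr[OF _ T]) (simp_all add: comp_def T_def Y_def)
  also have "\<dots> = (\<Pi>\<^sub>M i\<in>UNIV. distr M borel (X i))"
    using indep unfolding P_def by (subst (asm) indep_vars_iff_distr_eq_PiM) auto
  finally have "N.indep_vars (\<lambda>_. borel) Y UNIV"
    unfolding P_def by (subst N.indep_vars_iff_distr_eq_PiM) (auto simp: distr_Y)
  moreover have "integrable N (\<lambda>w. \<bar>Y i w\<bar> powr p)" for i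
    using adm unfolding admissible_sequence_def N_def
    by (subst integrable_distr_eq[OF T]) (simp_all add: T_def Y_def)
  ultimately have adm': "admissible_sequence p N Y"
    using adm N.prob_space_axioms
    by (simp add: admissible_sequence_def symmetrically_distributed_def distr_Y distr_mY)
  have norm_sum: "Lp_norm N q (\<lambda>w. \<Sum>i<n. Y i w) = Lp_norm M q (\<lambda>\<omega>. \<Sum>i<n. X i \<omega>)" for q
    unfolding Lp_norm_def N_def by (subst integral_distr[OF T]) (simp_all add: T_def Y_def)
  have norm: "Lp_norm N p (Y i) = Lp_norm M p (X i)" for i
    unfolding Lp_norm_def N_def by (subst integral_distr[OF T]) (simp_all add: T_def Y_def)
  have denom_eq: "rosenthal_denom p N Y n = rosenthal_denom p M X n"
    by (simp add: rosenthal_denom_def norm_sum norm)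
  then have "rosenthal_ratio p N Y n = rosenthal_ratio p M X n"
    by (simp add: rosenthal_ratio_def norm_sum)
  with adm' denom denom_eq show ?thesis
    unfolding rosenthal_ratios_def by (smt (verit) mem_Collect_eq)
qed

text \<open>
  By Rosenthal's inequality the set is bounded above for \<open>p \<ge> 2\<close>, so the real-valued supremum
  is the genuine one.
\<close>

definition rosenthal_S :: "real \<Rightarrow> real" where
  "rosenthal_S p = Sup (rosenthal_ratios p)"

definition rosenthal_K :: "real \<Rightarrow> real" where
  "rosenthal_K p = rosenthal_S p powr p"

text \<open>Only meant for open sets \<open>U\<close>, as \<^const>\<open>deriv\<close> is the two-sided derivative.\<close>

definition infinitely_differentiable_on :: "(real \<Rightarrow> real) \<Rightarrow> real set \<Rightarrow> bool" where
  "infinitely_differentiable_on f U \<longleftrightarrow>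
     (\<forall>k. \<forall>x\<in>U. (deriv ^^ k) f field_differentiable (at x))"

end

theory Submission
  imports Defs
begin

text \<open>
  For \<open>p > 4\<close> the constant \<open>K(p)\<close> is the \<open>p\<close>-th absolute moment of the difference of two independent
  Poisson(1/2) variables. This moment, like \<open>L(p)\<close>, is a rapidly convergent series of powers
  \<open>a powr p\<close> with bases \<open>a\<close> in the nonnegative integers, so it may be differentiated termwise.

  For the upper bound, normalise to \<open>\<Sum>E X\<^sub>i\<^sup>2 \<le> 1\<close> and \<open>\<Sum>E \<bar>X\<^sub>i\<bar>\<^sup>p \<le> 1\<close> and put \<open>f = \<bar>\<cdot>\<bar>\<^sup>p\<close>. Let \<open>A\<^sub>i = Q\<^sub>i - 1\<close>,
  where \<open>Q\<^sub>i\<close> is convolution with the law of \<open>X\<^sub>i\<close>, and let \<open>A\<close> be the operator obtained from jumps \<open>\<plusminus>1\<close>.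
  The quotient \<open>(f(z + x) + f(z - x) - 2 f(z)) / x\<^sup>2\<close> is concave in \<open>x\<^sup>p\<^sup>-\<^sup>2\<close>, whence
  \<open>\<Sum>A\<^sub>i f \<le> A f\<close> pointwise. Since \<open>A\<^sub>i\<^sup>2 f \<ge> 0\<close>, Bernoulli's inequality gives \<open>Q\<^sub>i f \<le> (1 + A\<^sub>i/m)\<^sup>m f\<close>, and the
  product over \<open>i\<close> is at most \<open>(1 + A/m)\<^sup>m f + O(1/m)\<close>. The error is controlled by \<open>cosh\<close>, a common
  eigenfunction of all operators involved. Letting \<open>m\<close> tend to infinity turns \<open>(1 + A/m)\<^sup>m f(0)\<close> into the
  Poisson moment; these same approximants show that the bound is sharp.
\<close>

section \<open>Second differences of powers\<close>

text \<open>Signed power. Together with \<open>\<bar>x\<bar> powr r\<close> it forms a pair closed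
  under differentiation up to constant factors, so second differences can be differentiated
  repeatedly across 0 without case splits.\<close>

definition spow :: "real \<Rightarrow> real \<Rightarrow> real" where
  "spow r x = sgn x * \<bar>x\<bar> powr r"

lemma tendsto_abs_powr_0:
  assumes "r > 0"
  shows "((\<lambda>h::real. \<bar>h\<bar> powr r) \<longlongrightarrow> 0) (at 0)"
proof -
  have "((\<lambda>h::real. \<bar>h\<bar> powr r) \<longlongrightarrow> \<bar>0\<bar> powr r) (at 0)"
    by (rule tendsto_powr'[OF _ tendsto_const]) (use assms in \<open>auto intro!: tendsto_eq_intros\<close>)
  then show ?thesis by simp
qed

text \<open>Away from 0 this is the ordinary power rule on a half line. At 0 the difference quotient
  is \<open>sgn h * \<bar>h\<bar> powr (r - 1)\<close>, which tends to 0 because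
  \<open>r > 1\<close>.\<close>

lemma DERIV_abs_powr:
  assumes "r > 1"
  shows "((\<lambda>x. \<bar>x\<bar> powr r) has_real_derivative r * spow (r - 1) x) (at x)"
proof (cases x "0 :: real" rule: linorder_cases)
  case less
  have "((\<lambda>x. (-x) powr r) has_real_derivative r * spow (r - 1) x) (at x)"
    using less by (auto intro!: derivative_eq_intros simp: spow_def)
  moreover have "\<forall>\<^sub>F y in nhds x. (- y) powr r = \<bar>y\<bar> powr r"
    using eventually_nhds_in_open[of "{..<0}" x] less by (auto elim!: eventually_mono)
  ultimately show ?thesis
    using DERIV_cong_ev[OF refl _ refl] by fast
next
  case greater
  have "((\<lambda>x. x powr r) has_real_derivative r * spow (r - 1) x) (at x)"
    using greater by (auto intro!: derivative_eq_intros simp: spow_def)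
  moreover have "\<forall>\<^sub>F y in nhds x. y powr r = \<bar>y\<bar> powr r"
    using eventually_nhds_in_open[of "{0<..}" x] greater by (auto elim!: eventually_mono)
  ultimately show ?thesis
    using DERIV_cong_ev[OF refl _ refl] by fast
next
  case equal
  have "((\<lambda>h. sgn h * \<bar>h\<bar> powr (r - 1)) \<longlongrightarrow> 0) (at (0::real))"
  proof (rule Lim_null_comparison[OF _ tendsto_abs_powr_0[of "r - 1"]])
    show "\<forall>\<^sub>F h in at 0. norm (sgn h * \<bar>h\<bar> powr (r - 1)) \<le> \<bar>h\<bar> powr (r - 1)"
      by (auto simp: abs_mult abs_sgn_eq intro!: always_eventually)
  qed (use assms in auto)
  moreover have "\<forall>\<^sub>F h in at (0::real). sgn h * \<bar>h\<bar> powr (r - 1) = (\<bar>0 + h\<bar> powr r - \<bar>0\<bar> powr r) / h"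
    by (auto simp: eventually_at_filter powr_diff sgn_if intro!: always_eventually)
  ultimately have "((\<lambda>h. (\<bar>0 + h\<bar> powr r - \<bar>0\<bar> powr r) / h) \<longlongrightarrow> 0) (at (0::real))"
    using tendsto_cong by fast
  then show ?thesis
    using equal by (simp add: DERIV_def spow_def)
qed

lemma DERIV_spow:
  assumes "r > 1"
  shows "(spow r has_real_derivative r * \<bar>x\<bar> powr (r - 1)) (at x)"
proof (cases x "0 :: real" rule: linorder_cases)
  case less
  have "((\<lambda>x. - ((-x) powr r)) has_real_derivative r * \<bar>x\<bar> powr (r - 1)) (at x)"
    using less by (auto intro!: derivative_eq_intros)
  moreover have "\<forall>\<^sub>F y in nhds x. - ((- y) powr r) = spow r y"
    using eventually_nhds_in_open[of "{..<0}" x] less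
    by (auto elim!: eventually_mono simp: spow_def)
  ultimately show ?thesis
    using DERIV_cong_ev[OF refl _ refl] by fast
next
  case greater
  have "((\<lambda>x. x powr r) has_real_derivative r * \<bar>x\<bar> powr (r - 1)) (at x)"
    using greater by (auto intro!: derivative_eq_intros)
  moreover have "\<forall>\<^sub>F y in nhds x. y powr r = spow r y"
    using eventually_nhds_in_open[of "{0<..}" x] greater
    by (auto elim!: eventually_mono simp: spow_def)
  ultimately show ?thesis
    using DERIV_cong_ev[OF refl _ refl] by fast
next
  case equal
  have "\<forall>\<^sub>F h in at (0::real). \<bar>h\<bar> powr (r - 1) = (spow r (0 + h) - spow r 0) / h"
    by (auto simp: eventually_at_filter powr_diff sgn_if spow_def intro!: always_eventually)
  then have "((\<lambda>h. (spow r (0 + h) - spow r 0) / h) \<longlongrightarrow> 0) (at (0::real))"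
    using tendsto_abs_powr_0[of "r - 1"] assms tendsto_cong by fastforce
  then show ?thesis
    using equal by (simp add: DERIV_def)
qed

lemmas DERIV_abs_powr' [derivative_intros] = DERIV_abs_powr[THEN DERIV_chain2]
lemmas DERIV_spow' [derivative_intros] = DERIV_spow[THEN DERIV_chain2]

lemma DERIV_nonneg_from_0:
  fixes f :: "real \<Rightarrow> real"
  assumes "\<And>x. (f has_real_derivative f' x) (at x)" "f 0 = 0" "\<And>x. x \<ge> 0 \<Longrightarrow> f' x \<ge> 0" "x \<ge> 0"
  shows "f x \<ge> 0"
  using DERIV_nonneg_imp_nondecreasing[of 0 x f] assms by fastforce

text \<open>Up to a positive factor the left side is the derivative of
  \<open>(x * T1 x - 2 * T x) / x powr p\<close>, so its sign gives the concavity used below. It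
  vanishes at 0 with its first derivative, and its second derivative reduces to a comparison of
  \<open>T3\<close> and \<open>T4\<close>. The hypothesis \<open>p > 4\<close> lets
  \<open>DERIV_spow\<close> apply at exponent \<open>p - 3\<close> and makes
  \<open>powr (p - 4)\<close> monotone.\<close>

lemma second_difference_ode_ineq:
  fixes p z x :: real
  assumes p: "p > 4" and z: "z \<ge> 0" and x: "x \<ge> 0"
  defines "T \<equiv> \<lambda>x. (\<bar>z + x\<bar> powr p + \<bar>z - x\<bar> powr p) / 2 - \<bar>z\<bar> powr p"
  defines "T1 \<equiv> \<lambda>x. p / 2 * (spow (p - 1) (z + x) - spow (p - 1) (z - x))"
  defines "T2 \<equiv> \<lambda>x. p * (p - 1) / 2 * (\<bar>z + x\<bar> powr (p - 2) + \<bar>z - x\<bar> powr (p - 2))"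
  shows "x\<^sup>2 * T2 x - (p + 1) * x * T1 x + 2 * p * T x \<le> 0"
proof -
  define T3 where "T3 = (\<lambda>x. p * (p - 1) * (p - 2) / 2 * (spow (p - 3) (z + x) - spow (p - 3) (z - x)))"
  define T4 where "T4 = (\<lambda>x. p * (p - 1) * (p - 2) * (p - 3) / 2 *
    (\<bar>z + x\<bar> powr (p - 4) + \<bar>z - x\<bar> powr (p - 4)))"
  have D [derivative_intros]:
    "(T has_real_derivative T1 x) (at x)" "(T1 has_real_derivative T2 x) (at x)"
    "(T2 has_real_derivative T3 x) (at x)" "(T3 has_real_derivative T4 x) (at x)" for x
    unfolding T_def T1_def T2_def T3_def T4_def using p
    by (auto intro!: derivative_eq_intros) (simp_all add: algebra_simps)
  \<comment> \<open>Writing \<open>spow (p - 3) y\<close> as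
    \<open>y * \<bar>y\<bar> powr (p - 4)\<close>, the terms with factor \<open>x\<close> cancel,
    and what remains is \<open>z\<close> times the comparison of \<open>\<bar>z - x\<bar>\<close>
    with \<open>\<bar>z + x\<bar>\<close>.\<close>
  have key: "x * T4 x \<le> (p - 3) * T3 x" if "x \<ge> 0" for x
  proof -
    have spow_eq: "spow (p - 3) y = y * \<bar>y\<bar> powr (p - 4)" for y
      using powr_mult_base[of "\<bar>y\<bar>" "p - 4"] by (auto simp: spow_def sgn_if)
    have "\<bar>z - x\<bar> powr (p - 4) \<le> \<bar>z + x\<bar> powr (p - 4)"
      using that z p by (intro powr_mono2) auto
    then have "z * \<bar>z - x\<bar> powr (p - 4) \<le> z * \<bar>z + x\<bar> powr (p - 4)"
      using z by (rule mult_left_mono)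
    then have "x * (\<bar>z + x\<bar> powr (p - 4) + \<bar>z - x\<bar> powr (p - 4))
        \<le> spow (p - 3) (z + x) - spow (p - 3) (z - x)"
      by (simp add: spow_eq algebra_simps)
    then have "p * (p - 1) * (p - 2) * (p - 3) / 2 * (x * (\<bar>z + x\<bar> powr (p - 4) + \<bar>z - x\<bar> powr (p - 4)))
        \<le> p * (p - 1) * (p - 2) * (p - 3) / 2 * (spow (p - 3) (z + x) - spow (p - 3) (z - x))"
      using p by (intro mult_left_mono) auto
    then show ?thesis
      by (simp add: T3_def T4_def mult.assoc mult.left_commute)
  qed
  \<comment> \<open>\<open>w\<close> is minus the expression to be bounded; \<open>w1 = w'\<close> and \<open>w2 = w''\<close>\<close>
  define w2 where "w2 = (\<lambda>x. x * ((p - 3) * T3 x - x * T4 x))"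
  define w1 where "w1 = (\<lambda>x. - (x\<^sup>2 * T3 x - (p - 1) * x * T2 x + (p - 1) * T1 x))"
  define w where "w = (\<lambda>x. - (x\<^sup>2 * T2 x - (p + 1) * x * T1 x + 2 * p * T x))"
  have "(w1 has_real_derivative w2 x) (at x)" for x
    unfolding w1_def w2_def
    by (auto intro!: derivative_eq_intros simp: algebra_simps power2_eq_square)
  moreover have "w1 0 = 0" by (simp add: w1_def T1_def)
  moreover have "w2 x \<ge> 0" if "x \<ge> 0" for x
    using key[OF that] that by (simp add: w2_def)
  ultimately have w1: "w1 x \<ge> 0" if "x \<ge> 0" for x
    using DERIV_nonneg_from_0 that by blast
  have "(w has_real_derivative w1 x) (at x)" for x
    unfolding w1_def w_def
    by (auto intro!: derivative_eq_intros simp: algebra_simps power2_eq_square)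
  moreover have "w 0 = 0" by (simp add: w_def T_def)
  ultimately have "w x \<ge> 0"
    using DERIV_nonneg_from_0 w1 x by blast
  then show ?thesis by (simp add: w_def)
qed

text \<open>As a function of \<open>x powr (p - 2)\<close>, the quotient \<open>T x / x\<^sup>2\<close> is concave; the bound is its
  tangent line at \<open>x = 1\<close>.\<close>

lemma second_difference_tangent_pos:
  fixes p z :: real
  assumes p: "p > 4" and z: "z \<ge> 0"
  defines "T \<equiv> \<lambda>x. (\<bar>z + x\<bar> powr p + \<bar>z - x\<bar> powr p) / 2 - \<bar>z\<bar> powr p"
  shows "\<exists>a b. a \<ge> 0 \<and> b \<ge> 0 \<and> a + b = T 1 \<and> (\<forall>x>0. T x \<le> a * x\<^sup>2 + b * x powr p)"
proof -
  define T1 where "T1 = (\<lambda>x. p / 2 * (spow (p - 1) (z + x) - spow (p - 1) (z - x)))"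
  define T2 where "T2 = (\<lambda>x. p * (p - 1) / 2 * (\<bar>z + x\<bar> powr (p - 2) + \<bar>z - x\<bar> powr (p - 2)))"
  define T3 where "T3 = (\<lambda>x. p * (p - 1) * (p - 2) / 2 * (spow (p - 3) (z + x) - spow (p - 3) (z - x)))"
  have D [derivative_intros]:
    "(T has_real_derivative T1 x) (at x)" "(T1 has_real_derivative T2 x) (at x)"
    "(T2 has_real_derivative T3 x) (at x)" for x
    unfolding T_def T1_def T2_def T3_def using p
    by (auto intro!: derivative_eq_intros) (simp_all add: algebra_simps)
  \<comment> \<open>With \<open>u = x powr (p - 2)\<close>, the derivative of
    \<open>T x / x\<^sup>2\<close> with respect to \<open>u\<close> is \<open>N x / (p - 2)\<close>;
    thus \<open>N\<close> decreasing is the concavity in question.\<close>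
  define N where "N = (\<lambda>x. (x * T1 x - 2 * T x) / x powr p)"
  have N_anti: "N y \<le> N x" if "0 < x" "x \<le> y" for x y
  proof -
    have "\<exists>d. ((\<lambda>x. - N x) has_real_derivative d) (at u) \<and> d \<ge> 0" if "x \<le> u" for u
    proof -
      have u: "u > 0" using that \<open>0 < x\<close> by simp
      define q where "q = u powr (p - 1)"
      have q: "q > 0" "u powr p = u * q"
        using u powr_mult_base[of u "p - 1"] by (auto simp: q_def)
      have "(N has_real_derivative
          ((1 * T1 u + T2 u * u - 2 * T1 u) * u powr p - (u * T1 u - 2 * T u) * (p * q))
            / (u powr p * u powr p)) (at u)"
        unfolding N_def q_def using u
        by (intro DERIV_divide DERIV_diff DERIV_mult DERIV_cmult DERIV_ident D has_real_derivative_powr) auto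
      moreover have "((1 * T1 u + T2 u * u - 2 * T1 u) * u powr p - (u * T1 u - 2 * T u) * (p * q))
            / (u powr p * u powr p) =
          (u\<^sup>2 * T2 u - (p + 1) * u * T1 u + 2 * p * T u) / (u * u powr p)"
        using u q(1) unfolding q(2) by (simp add: divide_simps) (simp add: power2_eq_square algebra_simps)
      ultimately have "((\<lambda>x. - N x) has_real_derivative
          - ((u\<^sup>2 * T2 u - (p + 1) * u * T1 u + 2 * p * T u) / (u * u powr p))) (at u)"
        using DERIV_minus by metis
      moreover have "u\<^sup>2 * T2 u - (p + 1) * u * T1 u + 2 * p * T u \<le> 0"
        using second_difference_ode_ineq[OF p z, of u] u by (simp add: T_def T1_def T2_def)
      ultimately show ?thesis
        using u by (intro exI conjI) (auto simp: divide_nonpos_pos)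
    qed
    then have "- N x \<le> - N y"
      using that by (intro DERIV_nonneg_imp_nondecreasing[where f = "\<lambda>x. - N x"]) auto
    then show ?thesis by simp
  qed
  \<comment> \<open>The quotient minus the linear part of its tangent at 1; by the monotonicity of
    \<open>N\<close> it is maximal at \<open>x = 1\<close>.\<close>
  define G where "G = (\<lambda>x. T x / x\<^sup>2 - N 1 / (p - 2) * x powr (p - 2))"
  have G_deriv: "(G has_real_derivative (N x - N 1) * x powr (p - 3)) (at x)" if "x > 0" for x
  proof -
    have "((\<lambda>x. T x / x\<^sup>2) has_real_derivative (T1 x * x\<^sup>2 - T x * (2 * x)) / (x\<^sup>2 * x\<^sup>2)) (at x)"
      by (rule derivative_eq_intros D refl | use that in simp)+
    moreover have "((\<lambda>x. N 1 / (p - 2) * x powr (p - 2)) has_real_derivative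
        N 1 / (p - 2) * ((p - 2) * x powr (p - 2 - 1))) (at x)"
      by (intro DERIV_cmult has_real_derivative_powr that)
    ultimately have "(G has_real_derivative (T1 x * x\<^sup>2 - T x * (2 * x)) / (x\<^sup>2 * x\<^sup>2)
        - N 1 / (p - 2) * ((p - 2) * x powr (p - 2 - 1))) (at x)"
      unfolding G_def by (rule DERIV_diff)
    moreover have "N x * x powr (p - 3) = (T1 x * x\<^sup>2 - T x * (2 * x)) / (x\<^sup>2 * x\<^sup>2)"
      using that by (simp add: N_def powr_diff field_simps power2_eq_square power3_eq_cube)
    moreover have "N 1 / (p - 2) * ((p - 2) * x powr (p - 2 - 1)) = N 1 * x powr (p - 3)"
      using p by simp
    ultimately show ?thesis
      by (simp add: left_diff_distrib)
  qed
  have G: "G x \<le> G 1" if "x > 0" for x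
  proof (cases "x \<le> 1")
    case True
    show ?thesis
    proof (rule DERIV_nonneg_imp_nondecreasing[OF True])
      fix y :: real assume y: "x \<le> y" "y \<le> 1"
      then have "(N y - N 1) * y powr (p - 3) \<ge> 0"
        using N_anti[of y 1] that by auto
      then show "\<exists>d. (G has_real_derivative d) (at y) \<and> 0 \<le> d"
        using G_deriv[of y] y that by auto
    qed
  next
    case False
    have "- G 1 \<le> - G x"
    proof (rule DERIV_nonneg_imp_nondecreasing[of 1 x])
      fix y :: real assume "1 \<le> y"
      then have "((\<lambda>x. - G x) has_real_derivative - ((N y - N 1) * y powr (p - 3))) (at y)"
        by (intro DERIV_minus G_deriv) auto
      moreover have "(N y - N 1) * y powr (p - 3) \<le> 0"
        using N_anti[of 1 y] \<open>1 \<le> y\<close> by (intro mult_nonpos_nonneg) auto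
      ultimately show "\<exists>d. ((\<lambda>x. - G x) has_real_derivative d) (at y) \<and> 0 \<le> d"
        by (metis neg_0_le_iff_le)
    qed (use False in auto)
    then show ?thesis by simp
  qed
  define b where "b = N 1 / (p - 2)"
  define a where "a = T 1 - b"
  have bound: "T x / x\<^sup>2 \<le> a + b * x powr (p - 2)" if "x > 0" for x
    using G[OF that] by (simp add: G_def a_def b_def)
  have T_nonneg: "T x \<ge> 0" if "x \<ge> 0" for x
  proof (rule DERIV_nonneg_from_0[of T T1])
    fix x :: real assume "x \<ge> 0"
    show "T1 x \<ge> 0"
    proof (rule DERIV_nonneg_from_0[of T1 T2])
      show "T2 x \<ge> 0" for x using p by (simp add: T2_def)
    qed (use D \<open>x \<ge> 0\<close> in \<open>auto simp: T1_def\<close>)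
  qed (use D that in \<open>auto simp: T_def\<close>)
  \<comment> \<open>The tangent line lies above the nonnegative quotient, hence is nonnegative on
    the whole half line \<open>t > 0\<close>. Letting \<open>t\<close> be small forces
    \<open>a \<ge> 0\<close>, letting it be large forces \<open>b \<ge> 0\<close>.\<close>
  have ab: "a + b * t \<ge> 0" if "t > 0" for t
  proof -
    have "0 \<le> T (t powr (1 / (p - 2))) / (t powr (1 / (p - 2)))\<^sup>2"
      using T_nonneg by (intro divide_nonneg_nonneg) auto
    also have "\<dots> \<le> a + b * (t powr (1 / (p - 2))) powr (p - 2)"
      using that by (intro bound) auto
    also have "\<dots> = a + b * t"
      using that p by (simp add: powr_powr)
    finally show ?thesis .
  qed
  have "a \<ge> 0"
  proof (rule ccontr)
    assume "\<not> a \<ge> 0"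
    \<comment> \<open>Small enough that \<open>b * t\<close> is at most \<open>- a / 2\<close>,
      leaving \<open>a + b * t\<close> negative.\<close>
    define t where "t = - a / (2 * (\<bar>b\<bar> + 1))"
    have t: "t > 0" "(\<bar>b\<bar> + 1) * t = - a / 2"
      using \<open>\<not> a \<ge> 0\<close> by (auto simp: t_def field_simps)
    have "b * t \<le> (\<bar>b\<bar> + 1) * t"
      using t by (intro mult_right_mono) auto
    then show False
      using ab[OF t(1)] t(2) \<open>\<not> a \<ge> 0\<close> by linarith
  qed
  moreover have "b \<ge> 0"
  proof (rule ccontr)
    assume "\<not> b \<ge> 0"
    define t where "t = (\<bar>a\<bar> + 1) / (- b)"
    have "t > 0" "b * t = - (\<bar>a\<bar> + 1)"
      using \<open>\<not> b \<ge> 0\<close> by (auto simp: t_def divide_pos_neg)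
    then show False
      using ab[of t] by linarith
  qed
  moreover have "T x \<le> a * x\<^sup>2 + b * x powr p" if "x > 0" for x
  proof -
    have "T x = (T x / x\<^sup>2) * x\<^sup>2" using that by simp
    also have "\<dots> \<le> (a + b * x powr (p - 2)) * x\<^sup>2"
      by (intro mult_right_mono bound that) simp
    also have "\<dots> = a * x\<^sup>2 + b * x powr p"
      using that by (simp add: powr_diff field_simps)
    finally show ?thesis .
  qed
  ultimately show ?thesis
    by (intro exI[of _ a] exI[of _ b]) (auto simp: a_def)
qed

text \<open>Changing the sign of \<open>z\<close> or \<open>x\<close> only swaps the two outer
  terms, which reduces to \<open>z \<ge> 0\<close> and \<open>x > 0\<close>. The same
  \<open>a\<close> and \<open>b\<close> serve all jumps \<open>x\<close>, so averaging over jumps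
  whose total second and \<open>p\<close>-th moments are at most 1 gives at most
  \<open>a + b\<close>, the value for unit jumps.\<close>

lemma second_difference_tangent:
  fixes p z :: real
  assumes "p > 4"
  shows "\<exists>a b. a \<ge> 0 \<and> b \<ge> 0 \<and>
    a + b = (\<bar>z + 1\<bar> powr p + \<bar>z - 1\<bar> powr p) / 2 - \<bar>z\<bar> powr p \<and>
    (\<forall>x. (\<bar>z + x\<bar> powr p + \<bar>z - x\<bar> powr p) / 2 - \<bar>z\<bar> powr p \<le> a * x\<^sup>2 + b * \<bar>x\<bar> powr p)"
proof -
  have swap: "\<bar>\<bar>z\<bar> + \<bar>x\<bar>\<bar> powr p + \<bar>\<bar>z\<bar> - \<bar>x\<bar>\<bar> powr p = \<bar>z + x\<bar> powr p + \<bar>z - x\<bar> powr p" for x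
  proof -
    have "\<bar>\<bar>z\<bar> + \<bar>x\<bar>\<bar> = \<bar>z + x\<bar> \<and> \<bar>\<bar>z\<bar> - \<bar>x\<bar>\<bar> = \<bar>z - x\<bar> \<or>
          \<bar>\<bar>z\<bar> + \<bar>x\<bar>\<bar> = \<bar>z - x\<bar> \<and> \<bar>\<bar>z\<bar> - \<bar>x\<bar>\<bar> = \<bar>z + x\<bar>"
      by (cases "z \<ge> 0"; cases "x \<ge> 0") (auto simp: abs_if)
    then show ?thesis by auto
  qed
  obtain a b where ab: "a \<ge> 0" "b \<ge> 0"
    "a + b = (\<bar>\<bar>z\<bar> + 1\<bar> powr p + \<bar>\<bar>z\<bar> - 1\<bar> powr p) / 2 - \<bar>z\<bar> powr p"
    "\<And>x. x > 0 \<Longrightarrow> (\<bar>\<bar>z\<bar> + x\<bar> powr p + \<bar>\<bar>z\<bar> - x\<bar> powr p) / 2 - \<bar>z\<bar> powr p \<le> a * x\<^sup>2 + b * x powr p"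
    using second_difference_tangent_pos[OF assms, of "\<bar>z\<bar>"] by auto
  have "(\<bar>z + x\<bar> powr p + \<bar>z - x\<bar> powr p) / 2 - \<bar>z\<bar> powr p \<le> a * x\<^sup>2 + b * \<bar>x\<bar> powr p" for x
    using ab(4)[of "\<bar>x\<bar>"] swap[of x] by (cases "x = 0") auto
  then show ?thesis
    using ab swap[of 1] by (intro exI[of _ a] exI[of _ b]) auto
qed

section \<open>Operators generated by translations\<close>

text \<open>Convolution with a finitely supported measure, given as a list of weights and shifts;
  repeated shifts are allowed, so sums of operators are appended lists.\<close>

definition conv_list :: "(real \<times> real) list \<Rightarrow> (real \<Rightarrow> real) \<Rightarrow> real \<Rightarrow> real" where
  "conv_list l f z = (\<Sum>cx\<leftarrow>l. fst cx * f (z + snd cx))"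

text \<open>Nonnegative weights make these operators monotone, and being built from translations
  makes them linear and mutually commuting. The class is closed under sums, compositions and powers,
  so the whole comparison can be done without integrals.\<close>

definition trans_op :: "((real \<Rightarrow> real) \<Rightarrow> real \<Rightarrow> real) \<Rightarrow> bool" where
  "trans_op Q \<longleftrightarrow> (\<exists>l. (\<forall>cx\<in>set l. fst cx \<ge> 0) \<and> Q = conv_list l)"

lemma trans_op_conv_list: "\<forall>cx\<in>set l. fst cx \<ge> 0 \<Longrightarrow> trans_op (conv_list l)"
  unfolding trans_op_def by blast

lemma trans_opE:
  assumes "trans_op Q"
  obtains l where "\<forall>cx\<in>set l. fst cx \<ge> 0" "Q = conv_list l"
  using assms unfolding trans_op_def by blast

lemma conv_list_Nil [simp]: "conv_list [] f z = 0"
  by (simp add: conv_list_def)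

lemma conv_list_Cons [simp]: "conv_list (cx # l) f z = fst cx * f (z + snd cx) + conv_list l f z"
  by (simp add: conv_list_def)

lemma conv_list_append [simp]: "conv_list (l @ l') f z = conv_list l f z + conv_list l' f z"
  by (simp add: conv_list_def)

lemma conv_list_scale_shift:
  "conv_list (map (\<lambda>dy. (c * fst dy, x + snd dy)) l) f z = c * conv_list l f (z + x)"
  by (induction l) (simp_all add: algebra_simps)

lemma trans_op_scale_shift:
  assumes "trans_op Q" "c \<ge> 0"
  shows "trans_op (\<lambda>f z. c * Q f (z + x))"
proof -
  obtain l where l: "\<forall>cx\<in>set l. fst cx \<ge> 0" and Q: "Q = conv_list l"
    using assms(1) by (rule trans_opE)
  have "trans_op (conv_list (map (\<lambda>dy. (c * fst dy, x + snd dy)) l))"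
    using l assms(2) by (intro trans_op_conv_list) auto
  moreover have "conv_list (map (\<lambda>dy. (c * fst dy, x + snd dy)) l) = (\<lambda>f z. c * Q f (z + x))"
    by (intro ext) (simp add: conv_list_scale_shift Q)
  ultimately show ?thesis by simp
qed

lemma trans_op_id: "trans_op (\<lambda>f. f)"
proof -
  have "trans_op (conv_list [(1, 0)])" by (rule trans_op_conv_list) auto
  moreover have "conv_list [(1, 0)] = (\<lambda>f. f)" by (intro ext) simp
  ultimately show ?thesis by simp
qed

lemma trans_op_shift: "trans_op (\<lambda>f z. f (z + x))"
  using trans_op_scale_shift[OF trans_op_id, of 1 x] by simp

lemma trans_op_scale: "c \<ge> 0 \<Longrightarrow> trans_op Q \<Longrightarrow> trans_op (\<lambda>f z. c * Q f z)"
  using trans_op_scale_shift[of Q c 0] by simp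

lemma trans_op_plus:
  assumes "trans_op Q" "trans_op R"
  shows "trans_op (\<lambda>f z. Q f z + R f z)"
proof -
  obtain l l' where l: "\<forall>cx\<in>set l. fst cx \<ge> 0" "Q = conv_list l"
    and l': "\<forall>cx\<in>set l'. fst cx \<ge> 0" "R = conv_list l'"
    using assms by (metis trans_opE)
  have "trans_op (conv_list (l @ l'))"
    using l l' by (intro trans_op_conv_list) auto
  moreover have "conv_list (l @ l') = (\<lambda>f z. Q f z + R f z)"
    by (intro ext) (simp add: l l')
  ultimately show ?thesis by simp
qed

lemma trans_op_comp:
  assumes "trans_op Q" "trans_op R"
  shows "trans_op (\<lambda>f. Q (R f))"
proof -
  obtain l where l: "\<forall>cx\<in>set l. fst cx \<ge> 0" and Q: "Q = conv_list l"
    using assms(1) by (rule trans_opE)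
  have "trans_op (\<lambda>f z. conv_list l (R f) z)"
    using l
  proof (induction l)
    case Nil
    show ?case using trans_op_scale[OF order.refl trans_op_id] by simp
  next
    case (Cons cx l)
    then show ?case
      using trans_op_plus[OF trans_op_scale_shift[OF assms(2), of "fst cx" "snd cx"], of "\<lambda>f z. conv_list l (R f) z"]
      by simp
  qed
  then show ?thesis by (simp add: Q)
qed

lemma trans_op_mono:
  assumes "trans_op Q" "\<And>z. f z \<le> g z"
  shows "Q f z \<le> Q g z"
proof -
  obtain l where l: "\<forall>cx\<in>set l. fst cx \<ge> 0" and Q: "Q = conv_list l"
    using assms(1) by (rule trans_opE)
  show ?thesis
    unfolding Q conv_list_def using l assms(2) by (intro sum_list_mono mult_left_mono) auto
qed

lemma trans_op_linear:
  assumes "trans_op Q"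
  shows "Q (\<lambda>z. a * f z + b * g z) = (\<lambda>z. a * Q f z + b * Q g z)"
proof -
  obtain l where Q: "Q = conv_list l"
    using assms(1) by (rule trans_opE)
  have "conv_list l (\<lambda>z. a * f z + b * g z) z = a * conv_list l f z + b * conv_list l g z" for z
    by (induction l) (simp_all add: algebra_simps)
  then show ?thesis by (auto simp: Q)
qed

lemma trans_op_commute_shift: "trans_op Q \<Longrightarrow> Q (\<lambda>z. f (z + x)) = (\<lambda>z. Q f (z + x))"
  by (erule trans_opE) (simp add: conv_list_def fun_eq_iff add_ac)

lemma trans_op_funpow: "trans_op Q \<Longrightarrow> trans_op (Q ^^ k)"
proof (induction k)
  case 0
  then show ?case using trans_op_id by (simp add: id_def)
next
  case (Suc k)
  then show ?case using trans_op_comp[of Q "Q ^^ k"] by (simp add: comp_def)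
qed

lemma trans_op_sum:
  assumes "finite I" "\<And>i. i \<in> I \<Longrightarrow> trans_op (Q i)"
  shows "trans_op (\<lambda>f z. \<Sum>i\<in>I. Q i f z)"
  using assms
proof (induction I rule: finite_induct)
  case empty
  then show ?case using trans_op_scale[OF _ trans_op_id, of 0] by simp
next
  case (insert i I)
  then show ?case by (simp add: trans_op_plus)
qed

lemma trans_op_add: "trans_op Q \<Longrightarrow> Q (\<lambda>z. f z + g z) = (\<lambda>z. Q f z + Q g z)"
  using trans_op_linear[of Q 1 f 1 g] by simp

lemma trans_op_diff: "trans_op Q \<Longrightarrow> Q (\<lambda>z. f z - g z) = (\<lambda>z. Q f z - Q g z)"
  using trans_op_linear[of Q 1 f "-1" g] by simp

lemma trans_op_cmult: "trans_op Q \<Longrightarrow> Q (\<lambda>z. c * f z) = (\<lambda>z. c * Q f z)"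
  using trans_op_linear[of Q c f 0 f] by simp

lemma trans_op_sum_arg:
  assumes "trans_op Q" "finite I"
  shows "Q (\<lambda>z. \<Sum>i\<in>I. f i z) = (\<lambda>z. \<Sum>i\<in>I. Q (f i) z)"
  using assms(2)
proof (induction I rule: finite_induct)
  case empty
  then show ?case using trans_op_cmult[OF assms(1), of 0] by simp
next
  case (insert i I)
  then show ?case by (simp add: trans_op_add[OF assms(1)])
qed

text \<open>\<open>R\<close> is a combination of translations, while \<open>Q\<close> is linear and
  commutes with each single translation.\<close>

lemma trans_op_commute:
  assumes "trans_op Q" "trans_op R"
  shows "Q (R f) = R (Q f)"
proof -
  obtain l where R: "R = conv_list l"
    using assms(2) by (rule trans_opE)
  have "Q (\<lambda>z. conv_list l f z) = (\<lambda>z. conv_list l (Q f) z)"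
  proof (induction l)
    case Nil
    show ?case using trans_op_cmult[OF assms(1), of 0 f] by simp
  next
    case (Cons cx l)
    then show ?case
      by (simp add: trans_op_add[OF assms(1)] trans_op_cmult[OF assms(1)] trans_op_commute_shift[OF assms(1)])
  qed
  then show ?thesis by (simp add: R)
qed

section \<open>Symmetric averages, lazy steps and products of operators\<close>

definition avg_shift :: "real \<Rightarrow> (real \<Rightarrow> real) \<Rightarrow> real \<Rightarrow> real" where
  "avg_shift x f z = (f (z + x) + f (z - x)) / 2"

lemma trans_op_avg_shift: "trans_op (avg_shift x)"
  using trans_op_scale[OF _ trans_op_plus[OF trans_op_shift[of x] trans_op_shift[of "-x"]], of "1/2"]
  by (simp add: avg_shift_def[abs_def])

text \<open>The addition formula makes \<open>cosh\<close> an eigenfunction for every jump size at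
  once; it therefore serves as the weight in all error bounds.\<close>

lemma avg_shift_cosh: "avg_shift x cosh = (\<lambda>z. cosh x * cosh z)"
  by (simp add: avg_shift_def cosh_add cosh_diff fun_eq_iff)

definition sym_op :: "real set \<Rightarrow> (real \<Rightarrow> real) \<Rightarrow> (real \<Rightarrow> real) \<Rightarrow> real \<Rightarrow> real" where
  "sym_op F w f z = (\<Sum>x\<in>F. w x * avg_shift x f z)"

lemma trans_op_sym_op:
  assumes "finite F" "\<And>x. x \<in> F \<Longrightarrow> w x \<ge> 0"
  shows "trans_op (sym_op F w)"
  unfolding sym_op_def[abs_def]
  using assms by (intro trans_op_sum trans_op_scale trans_op_avg_shift) auto

text \<open>This is \<open>1 + s * A\<close> with \<open>A = Q - 1\<close>; its \<open>m\<close>-th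
  power at \<open>s = 1 / m\<close> approximates the exponential of \<open>A\<close>.\<close>

definition lazy_op :: "real \<Rightarrow> ((real \<Rightarrow> real) \<Rightarrow> real \<Rightarrow> real) \<Rightarrow> (real \<Rightarrow> real) \<Rightarrow> real \<Rightarrow> real" where
  "lazy_op s Q f z = (1 - s) * f z + s * Q f z"

lemma trans_op_lazy_op:
  assumes "trans_op Q" "0 \<le> s" "s \<le> 1"
  shows "trans_op (lazy_op s Q)"
  unfolding lazy_op_def[abs_def]
  using assms by (intro trans_op_plus trans_op_scale trans_op_id) auto

text \<open>Bernoulli's inequality for \<open>1 + s * A\<close> with \<open>A = Q - 1\<close>. The
  assumption \<open>convex\<close> says that \<open>A\<close> applied twice to \<open>f\<close> is
  nonnegative, so the quadratic term produced by multiplying \<open>1 + m * s * A\<close> with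
  \<open>1 + s * A\<close> has the right sign. Positivity of the lazy operator carries the
  induction.\<close>

lemma lazy_op_bernoulli:
  assumes Q: "trans_op Q" and s: "0 \<le> s" "s \<le> 1"
    and convex: "\<And>z. Q (Q f) z - 2 * Q f z + f z \<ge> 0"
  shows "f z + real m * s * (Q f z - f z) \<le> (lazy_op s Q ^^ m) f z"
proof (induction m arbitrary: z)
  case 0
  then show ?case by simp
next
  case (Suc m)
  have "f z + real (Suc m) * s * (Q f z - f z)
      \<le> f z + real (Suc m) * s * (Q f z - f z) + real m * s * s * (Q (Q f) z - 2 * Q f z + f z)"
    using convex s by simp
  also have "\<dots> = lazy_op s Q (\<lambda>z. f z + real m * s * (Q f z - f z)) z"
  proof -
    have "Q (\<lambda>z. f z + real m * s * (Q f z - f z)) = (\<lambda>z. Q f z + real m * s * (Q (Q f) z - Q f z))"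
      by (simp only: trans_op_add[OF Q] trans_op_cmult[OF Q] trans_op_diff[OF Q])
    then show ?thesis by (simp add: lazy_op_def algebra_simps)
  qed
  also have "\<dots> \<le> lazy_op s Q ((lazy_op s Q ^^ m) f) z"
    by (rule trans_op_mono[OF trans_op_lazy_op[OF Q s] Suc])
  finally show ?case by simp
qed

primrec op_prod :: "(nat \<Rightarrow> (real \<Rightarrow> real) \<Rightarrow> real \<Rightarrow> real) \<Rightarrow> nat \<Rightarrow> (real \<Rightarrow> real) \<Rightarrow> real \<Rightarrow> real" where
  "op_prod Q 0 = (\<lambda>f. f)"
| "op_prod Q (Suc n) = (\<lambda>f. Q n (op_prod Q n f))"

lemma trans_op_op_prod: "(\<And>i. trans_op (Q i)) \<Longrightarrow> trans_op (op_prod Q n)"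
proof (induction n)
  case 0
  show ?case using trans_op_id by simp
next
  case (Suc n)
  show ?case using trans_op_comp[OF Suc.prems Suc.IH[OF Suc.prems]] by simp
qed

lemma op_prod_const: "op_prod (\<lambda>_. Q) n = Q ^^ n"
  by (induction n) (simp_all add: id_def comp_def)

text \<open>The factors are compared only at the single function \<open>f\<close>. Commutation
  therefore first brings \<open>Q n\<close> next to \<open>f\<close>, where it can be replaced by
  \<open>R n\<close>.\<close>

lemma op_prod_mono:
  assumes "\<And>i. trans_op (Q i)" "\<And>i. trans_op (R i)" "\<And>i z. Q i f z \<le> R i f z"
  shows "op_prod Q n f z \<le> op_prod R n f z"
proof (induction n arbitrary: z)
  case 0
  then show ?case by simp
next
  case (Suc n)
  have Qn: "trans_op (op_prod Q n)" using assms(1) by (rule trans_op_op_prod)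
  have "Q n (op_prod Q n f) z = op_prod Q n (Q n f) z"
    using trans_op_commute[OF assms(1) Qn] by simp
  also have "\<dots> \<le> op_prod Q n (R n f) z"
    by (rule trans_op_mono[OF Qn assms(3)])
  also have "\<dots> = R n (op_prod Q n f) z"
    using trans_op_commute[OF assms(2) Qn] by simp
  also have "\<dots> \<le> R n (op_prod R n f) z"
    by (rule trans_op_mono[OF assms(2) Suc])
  finally show ?case by simp
qed

lemma funpow_trans_op_comp:
  assumes "trans_op A" "trans_op B"
  shows "((\<lambda>f. A (B f)) ^^ m) f = (A ^^ m) ((B ^^ m) f)"
proof (induction m)
  case (Suc m)
  then show ?case
    using trans_op_commute[OF assms(2) trans_op_funpow[OF assms(1), of m]] by simp
qed simp

text \<open>Commutation regroups the factors, so that a product of \<open>m\<close>-th powers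
  becomes \<open>m\<close> repetitions of one product, to be compared with one step of a single
  walk.\<close>

lemma op_prod_funpow:
  assumes "\<And>i. trans_op (Q i)"
  shows "op_prod (\<lambda>i. Q i ^^ m) n f = (op_prod Q n ^^ m) f"
proof (induction n arbitrary: f)
  case 0
  have "((\<lambda>f::real \<Rightarrow> real. f) ^^ m) f = f" by (induction m) auto
  then show ?case by simp
next
  case (Suc n)
  then show ?case
    using funpow_trans_op_comp[OF assms[of n] trans_op_op_prod[where Q = Q and n = n, OF assms], of m f] by simp
qed

text \<open>First-order expansion of the product of the operators \<open>1 + s * (Q i - 1)\<close>.
  The constant \<open>C\<close> depends on \<open>n\<close> but is uniform in \<open>s\<close> and
  \<open>z\<close>; only an upper bound for the second-order terms is needed, with
  \<open>cosh\<close> as weight.\<close>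

lemma op_prod_lazy_expansion:
  assumes Q: "\<And>i. trans_op (Q i)" and cosh: "\<And>i. Q i cosh = (\<lambda>z. k i * cosh z)" "\<And>i. k i \<ge> 1"
    and f: "\<And>z. 0 \<le> f z" "\<And>z. f z \<le> C0 * cosh z"
  shows "\<exists>C\<ge>0. \<forall>s z. 0 \<le> s \<and> s \<le> 1 \<longrightarrow>
    op_prod (\<lambda>i. lazy_op s (Q i)) n f z \<le> f z + s * (\<Sum>i<n. Q i f z - f z) + s\<^sup>2 * C * cosh z"
proof (induction n)
  case 0
  then show ?case by auto
next
  case (Suc n)
  then obtain C where C: "C \<ge> 0" and IH: "\<And>s z. 0 \<le> s \<Longrightarrow> s \<le> 1 \<Longrightarrow>
    op_prod (\<lambda>i. lazy_op s (Q i)) n f z \<le> f z + s * (\<Sum>i<n. Q i f z - f z) + s\<^sup>2 * C * cosh z"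
    by auto
  have C0: "C0 \<ge> 0"
    using order_trans[OF f(1) f(2), of 0] by simp
  define D where "D = (\<Sum>i<n. C0 * (k i * k n) + C0)"
  have D: "D \<ge> 0" unfolding D_def using C0 cosh(2) order_trans[OF zero_le_one cosh(2)]
    by (intro sum_nonneg) auto
  \<comment> \<open>The mixed term has four parts. The two with a minus sign are discarded because
    \<open>f\<close> is nonnegative, and the two others are bounded through
    \<open>f z \<le> C0 * cosh z\<close> and the eigenvalues \<open>k\<close>.\<close>
  have cross: "(\<Sum>i<n. Q n (Q i f) z - Q n f z - (Q i f z - f z)) \<le> D * cosh z" for z
  proof -
    have "Q n (Q i f) z - Q n f z - (Q i f z - f z) \<le> (C0 * (k i * k n) + C0) * cosh z" for i
    proof -
      have pos: "Q i f z \<ge> 0" for i z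
        using trans_op_mono[OF Q[of i], of "\<lambda>_. 0 * f 0" f] f(1) trans_op_cmult[OF Q[of i], of 0 f]
        by simp
      have "Q i f z \<le> C0 * (k i * cosh z)" for i z
        using trans_op_mono[OF Q[of i], of f "\<lambda>z. C0 * cosh z"] f(2) by (simp add: trans_op_cmult Q cosh)
      then have "Q n (Q i f) z \<le> Q n (\<lambda>z. (C0 * k i) * cosh z) z"
        using trans_op_mono[OF Q[of n]] by (simp add: mult.assoc)
      also have "\<dots> = C0 * (k i * k n) * cosh z"
        by (simp only: trans_op_cmult[OF Q] cosh)
      finally show ?thesis
        using f(2)[of z] pos[of n z] pos[of i z] by (simp add: algebra_simps)
    qed
    then show ?thesis
      unfolding D_def sum_distrib_right by (intro sum_mono) auto
  qed
  have "op_prod (\<lambda>i. lazy_op s (Q i)) (Suc n) f z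
      \<le> f z + s * (\<Sum>i<Suc n. Q i f z - f z) + s\<^sup>2 * (D + C * k n) * cosh z"
    if s: "0 \<le> s" "s \<le> 1" for s z
  proof -
    define S where "S = (\<lambda>z. \<Sum>i<n. Q i f z - f z)"
    have R: "trans_op (lazy_op s (Q n))" by (rule trans_op_lazy_op[OF Q s])
    have QS: "Q n S = (\<lambda>z. \<Sum>i<n. Q n (Q i f) z - Q n f z)"
      unfolding S_def by (simp add: trans_op_sum_arg[OF Q] trans_op_diff[OF Q])
    have "lazy_op s (Q n) (op_prod (\<lambda>i. lazy_op s (Q i)) n f) z
        \<le> lazy_op s (Q n) (\<lambda>z. f z + s * S z + s\<^sup>2 * C * cosh z) z"
      unfolding S_def using IH s by (intro trans_op_mono[OF R]) auto
    also have "\<dots> = (1 - s) * (f z + s * S z + s\<^sup>2 * C * cosh z)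
        + s * (Q n f z + s * Q n S z + s\<^sup>2 * C * (k n * cosh z))"
      by (simp add: lazy_op_def trans_op_add[OF Q] trans_op_cmult[OF Q] cosh)
    also have "\<dots> = f z + s * (S z + (Q n f z - f z)) + s\<^sup>2 * (Q n S z - S z)
        + s\<^sup>2 * C * (1 + s * (k n - 1)) * cosh z"
      by (simp add: algebra_simps power2_eq_square)
    also have "\<dots> \<le> f z + s * (S z + (Q n f z - f z)) + s\<^sup>2 * (D * cosh z)
        + s\<^sup>2 * C * k n * cosh z"
    proof (intro add_mono order.refl)
      show "s\<^sup>2 * (Q n S z - S z) \<le> s\<^sup>2 * (D * cosh z)"
        using cross[of z] unfolding QS by (intro mult_left_mono) (simp_all add: S_def sum_subtractf)
      have "s * (k n - 1) \<le> 1 * (k n - 1)"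
        using s cosh(2)[of n] by (intro mult_right_mono) auto
      then show "s\<^sup>2 * C * (1 + s * (k n - 1)) * cosh z \<le> s\<^sup>2 * C * k n * cosh z"
        using C by (intro mult_right_mono mult_left_mono) auto
    qed
    finally show ?thesis by (simp add: S_def algebra_simps)
  qed
  moreover have "D + C * k n \<ge> 0"
    using D C cosh(2)[of n] by simp
  ultimately show ?case by blast
qed

text \<open>Each factor multiplies \<open>cosh\<close> by \<open>1 + s * (k i - 1)\<close>, at most
  an exponential. With \<open>s = 1 / m\<close> the growth over \<open>m\<close> repetitions thus
  stays bounded in \<open>m\<close>.\<close>

lemma op_prod_lazy_cosh:
  assumes Q: "\<And>i. trans_op (Q i)" and cosh: "\<And>i. Q i cosh = (\<lambda>z. k i * cosh z)" "\<And>i. k i \<ge> 1"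
    and s: "0 \<le> s" "s \<le> 1"
  shows "op_prod (\<lambda>i. lazy_op s (Q i)) n cosh z \<le> exp (s * (\<Sum>i<n. k i - 1)) * cosh z"
proof (induction n arbitrary: z)
  case 0
  then show ?case by simp
next
  case (Suc n)
  define E where "E = exp (s * (\<Sum>i<n. k i - 1))"
  have R: "trans_op (lazy_op s (Q n))" by (rule trans_op_lazy_op[OF Q s])
  have "lazy_op s (Q n) (op_prod (\<lambda>i. lazy_op s (Q i)) n cosh) z \<le> lazy_op s (Q n) (\<lambda>z. E * cosh z) z"
    unfolding E_def by (rule trans_op_mono[OF R Suc])
  also have "\<dots> = (1 + s * (k n - 1)) * (E * cosh z)"
    by (simp add: lazy_op_def trans_op_cmult[OF Q] cosh algebra_simps)
  also have "\<dots> \<le> exp (s * (k n - 1)) * (E * cosh z)"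
    by (intro mult_right_mono exp_ge_add_one_self) (simp add: E_def)
  also have "\<dots> = exp (s * (\<Sum>i<Suc n. k i - 1)) * cosh z"
    by (simp add: E_def exp_add[symmetric] distrib_left mult.assoc[symmetric] add.commute)
  finally show ?case by simp
qed

text \<open>The steps \<open>R\<close> are exchanged for \<open>P\<close> one at a time. Since the
  one-step comparison holds only at \<open>f\<close>, commutation moves the step to be exchanged
  next to \<open>f\<close>; every other step multiplies the error \<open>e * cosh\<close> by at most
  \<open>t\<close>. For \<open>k = m\<close>, \<open>e\<close> of order \<open>1 / m\<^sup>2\<close>
  and \<open>t ^ m\<close> bounded, the total error is of order \<open>1 / m\<close>.\<close>

lemma funpow_trans_op_perturb:
  assumes R: "trans_op R" and P: "trans_op P" and t: "t \<ge> 1" and e: "e \<ge> 0"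
    and cosh: "\<And>z. R cosh z \<le> t * cosh z" "\<And>z. P cosh z \<le> t * cosh z"
    and le: "\<And>z. R f z \<le> P f z + e * cosh z"
  shows "(R ^^ k) f z \<le> (P ^^ k) f z + e * real k * t ^ k * cosh z"
proof (induction k arbitrary: z)
  case 0
  then show ?case by simp
next
  case (Suc k)
  have Pk: "trans_op (P ^^ k)" by (rule trans_op_funpow[OF P])
  have Pk_cosh: "(P ^^ k) cosh z \<le> t ^ k * cosh z" for z
  proof (induction k arbitrary: z)
    case (Suc k)
    have "P ((P ^^ k) cosh) z \<le> P (\<lambda>z. t ^ k * cosh z) z"
      by (rule trans_op_mono[OF P Suc])
    also have "\<dots> \<le> t ^ k * (t * cosh z)"
      using t cosh(2) by (simp add: trans_op_cmult[OF P] mult_left_mono)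
    finally show ?case by (simp add: mult_ac)
  qed simp
  have "R ((R ^^ k) f) z \<le> R (\<lambda>z. (P ^^ k) f z + (e * real k * t ^ k) * cosh z) z"
    by (rule trans_op_mono[OF R Suc])
  also have "\<dots> = R ((P ^^ k) f) z + e * real k * t ^ k * R cosh z"
    by (simp only: trans_op_add[OF R] trans_op_cmult[OF R])
  also have "R ((P ^^ k) f) z = (P ^^ k) (R f) z"
    by (simp add: trans_op_commute[OF R Pk])
  also have "(P ^^ k) (R f) z \<le> (P ^^ k) (\<lambda>z. P f z + e * cosh z) z"
    by (rule trans_op_mono[OF Pk le])
  also have "\<dots> = (P ^^ k) (P f) z + e * (P ^^ k) cosh z"
    by (simp only: trans_op_add[OF Pk] trans_op_cmult[OF Pk])
  also have "(P ^^ k) (P f) = (P ^^ Suc k) f"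
    by (simp add: funpow_swap1)
  also have "(P ^^ Suc k) f z + e * (P ^^ k) cosh z + e * real k * t ^ k * R cosh z
      \<le> (P ^^ Suc k) f z + e * (t ^ k * cosh z) + e * real k * t ^ k * (t * cosh z)"
    using e t by (intro add_mono mult_left_mono order.refl Pk_cosh cosh) auto
  also have "\<dots> \<le> (P ^^ Suc k) f z + e * (t ^ Suc k * cosh z) + e * real k * t ^ k * (t * cosh z)"
    using e t by (intro add_mono mult_left_mono mult_right_mono order.refl power_increasing) auto
  also have "\<dots> = (P ^^ Suc k) f z + e * real (Suc k) * t ^ Suc k * cosh z"
    by (simp add: algebra_simps)
  finally show ?case by simp
qed

section \<open>Comparison with the lazy random walk\<close>

lemma convex_on_abs_powr:
  assumes "r > 2"
  shows "convex_on UNIV (\<lambda>x::real. \<bar>x\<bar> powr r)"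
proof (rule f''_ge0_imp_convex)
  fix x :: real
  show "((\<lambda>x. \<bar>x\<bar> powr r) has_real_derivative r * spow (r - 1) x) (at x)"
    using assms by (intro DERIV_abs_powr) auto
  show "((\<lambda>x. r * spow (r - 1) x) has_real_derivative r * ((r - 1) * \<bar>x\<bar> powr (r - 1 - 1))) (at x)"
    using assms by (intro DERIV_cmult DERIV_spow) auto
  show "0 \<le> r * ((r - 1) * \<bar>x\<bar> powr (r - 1 - 1))"
    using assms by simp
qed auto

lemma convex_on_le_avg_shift:
  assumes "convex_on UNIV g"
  shows "g z \<le> avg_shift x g z"
proof -
  have "g ((1 - 1/2) *\<^sub>R (z + x) + (1/2) *\<^sub>R (z - x)) \<le> (1 - 1/2) * g (z + x) + 1/2 * g (z - x)"
    by (rule convex_onD[OF assms]) auto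
  then show ?thesis by (simp add: avg_shift_def field_simps)
qed

text \<open>For \<open>f x = \<bar>x\<bar> powr p\<close> the second difference of \<open>f\<close> is convex because \<open>f''\<close> is, which makes
  fourth-order mixed differences nonnegative.\<close>

lemma avg_shift_mixed_difference_nonneg:
  assumes p: "p > 4"
  defines "f \<equiv> \<lambda>x::real. \<bar>x\<bar> powr p"
  shows "avg_shift x (avg_shift y f) z - avg_shift x f z - avg_shift y f z + f z \<ge> 0"
proof -
  define g where "g = (\<lambda>z. (\<bar>z + y\<bar> powr p + \<bar>z - y\<bar> powr p) / 2 - \<bar>z\<bar> powr p)"
  define g1 where "g1 = (\<lambda>z. p * ((spow (p - 1) (z + y) + spow (p - 1) (z - y)) / 2 - spow (p - 1) z))"
  define g2 where "g2 = (\<lambda>z. p * ((p - 1) * ((\<bar>z + y\<bar> powr (p - 2) + \<bar>z - y\<bar> powr (p - 2)) / 2 - \<bar>z\<bar> powr (p - 2))))"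
  have "convex_on UNIV g"
  proof (rule f''_ge0_imp_convex)
    fix x :: real
    show "(g has_real_derivative g1 x) (at x)"
      unfolding g_def g1_def using p by (auto intro!: derivative_eq_intros) (simp_all add: algebra_simps)
    show "(g1 has_real_derivative g2 x) (at x)"
      unfolding g1_def g2_def using p by (auto intro!: derivative_eq_intros) (simp_all add: field_simps)
    have "\<bar>x\<bar> powr (p - 2) \<le> avg_shift y (\<lambda>x. \<bar>x\<bar> powr (p - 2)) x"
      using p by (intro convex_on_le_avg_shift convex_on_abs_powr) auto
    then show "g2 x \<ge> 0"
      using p by (auto simp: g2_def avg_shift_def)
  qed auto
  then have "g z \<le> avg_shift x g z"
    by (rule convex_on_le_avg_shift)
  moreover have "g = (\<lambda>z. avg_shift y f z - f z)"
    by (auto simp: g_def avg_shift_def f_def)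
  ultimately show ?thesis
    by (simp add: trans_op_diff[OF trans_op_avg_shift])
qed

text \<open>The inequality \<open>\<bar>z\<bar> / p \<le> exp (\<bar>z\<bar> / p)\<close> is raised
  to the power \<open>p\<close>.\<close>

lemma abs_powr_le_cosh:
  fixes z p :: real
  assumes "p > 0"
  shows "\<bar>z\<bar> powr p \<le> 2 * p powr p * cosh z"
proof -
  have "\<bar>z\<bar> / p \<le> exp (\<bar>z\<bar> / p)"
    using exp_ge_add_one_self[of "\<bar>z\<bar> / p"] by linarith
  then have "\<bar>z\<bar> \<le> p * exp (\<bar>z\<bar> / p)"
    using assms by (simp add: field_simps)
  then have "\<bar>z\<bar> powr p \<le> (p * exp (\<bar>z\<bar> / p)) powr p"
    using assms by (intro powr_mono2) auto
  also have "\<dots> = p powr p * exp \<bar>z\<bar>"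
    using assms by (simp add: powr_mult powr_def[of "exp _"])
  also have "exp \<bar>z\<bar> \<le> 2 * cosh z"
    by (cases "z \<ge> 0") (auto simp: cosh_def)
  finally show ?thesis by (simp add: mult_left_mono mult.assoc mult.left_commute)
qed

text \<open>Bernoulli replaces each \<open>Q i\<close> by the \<open>m\<close>-th power of its lazy
  version, and regrouping gives the \<open>m\<close>-th power of one product \<open>R\<close>. The
  expansion and the tangent bound show that \<open>R\<close> at \<open>f\<close> exceeds a step
  \<open>P\<close> of the lazy simple walk by at most a multiple of
  \<open>cosh z / m\<^sup>2\<close>. The constant \<open>C\<close> may depend on \<open>n\<close>
  and the weights but not on \<open>m\<close>, which tends to infinity afterwards.\<close>

lemma op_prod_le_lazy_funpow:
  fixes w :: "nat \<Rightarrow> real \<Rightarrow> real" and p :: real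
  assumes p: "p > 4"
    and F: "\<And>i. finite (F i)" "\<And>i x. w i x \<ge> 0" "\<And>i. (\<Sum>x\<in>F i. w i x) = 1"
    and second: "(\<Sum>i<n. \<Sum>x\<in>F i. w i x * x\<^sup>2) \<le> 1"
    and pth: "(\<Sum>i<n. \<Sum>x\<in>F i. w i x * \<bar>x\<bar> powr p) \<le> 1"
  defines "f \<equiv> \<lambda>x::real. \<bar>x\<bar> powr p"
  shows "\<exists>C. \<forall>m\<ge>1. op_prod (\<lambda>i. sym_op (F i) (w i)) n f 0
    \<le> (lazy_op (1 / real m) (avg_shift 1) ^^ m) f 0 + C / real m"
proof -
  define Q where "Q = (\<lambda>i. sym_op (F i) (w i))"
  define k where "k = (\<lambda>i. \<Sum>x\<in>F i. w i x * cosh x)"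
  have Q: "trans_op (Q i)" for i
    unfolding Q_def using F by (intro trans_op_sym_op) auto
  have E: "trans_op (avg_shift 1)" by (rule trans_op_avg_shift)
  have Q_cosh: "Q i cosh = (\<lambda>z. k i * cosh z)" for i
    by (simp add: Q_def k_def sym_op_def[abs_def] avg_shift_cosh sum_distrib_right mult.assoc)
  have k: "k i \<ge> 1" for i
  proof -
    have "(\<Sum>x\<in>F i. w i x * 1) \<le> (\<Sum>x\<in>F i. w i x * cosh x)"
      using F(2) cosh_real_ge_1 by (intro sum_mono mult_left_mono) auto
    then show ?thesis using F(3)[of i] by (simp add: k_def)
  qed
  have f: "0 \<le> f z" "f z \<le> 2 * p powr p * cosh z" for z
    using abs_powr_le_cosh[of p z] p by (auto simp: f_def)
  \<comment> \<open>Since the weights sum to 1, all four terms are double sums over the same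
    weights; their combination is a weighted sum of the nonnegative mixed differences.\<close>
  have Q_convex: "Q i (Q i f) z - 2 * Q i f z + f z \<ge> 0" for i z
  proof -
    have "Q i (Q i f) z = (\<Sum>x\<in>F i. \<Sum>y\<in>F i. w i x * (w i y * avg_shift x (avg_shift y f) z))"
      unfolding Q_def sym_op_def[abs_def]
      by (subst trans_op_sum_arg[OF trans_op_avg_shift F(1)])
        (simp add: trans_op_cmult[OF trans_op_avg_shift] sum_distrib_left)
    moreover have "Q i f z = (\<Sum>x\<in>F i. \<Sum>y\<in>F i. w i x * (w i y * avg_shift x f z))"
      using F(3)[of i] unfolding Q_def sym_op_def
      by (simp add: sum_distrib_left[symmetric] sum_distrib_right[symmetric])
    moreover have "Q i f z = (\<Sum>x\<in>F i. \<Sum>y\<in>F i. w i x * (w i y * avg_shift y f z))"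
      using F(3)[of i] unfolding Q_def sym_op_def
      by (simp add: sum_distrib_left[symmetric] sum_distrib_right[symmetric])
    moreover have "f z = (\<Sum>x\<in>F i. \<Sum>y\<in>F i. w i x * (w i y * f z))"
      using F(3)[of i] by (simp add: sum_distrib_left[symmetric] sum_distrib_right[symmetric])
    ultimately have "Q i (Q i f) z - 2 * Q i f z + f z = (\<Sum>x\<in>F i. \<Sum>y\<in>F i. w i x * (w i y *
        (avg_shift x (avg_shift y f) z - avg_shift x f z - avg_shift y f z + f z)))"
      by (simp add: right_diff_distrib distrib_left sum_subtractf sum.distrib)
    also have "\<dots> \<ge> 0"
      using avg_shift_mixed_difference_nonneg[OF p] F(2) unfolding f_def
      by (intro sum_nonneg mult_nonneg_nonneg) auto
    finally show ?thesis .
  qed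
  \<comment> \<open>The coefficients \<open>a\<close> and \<open>b\<close> depend on
    \<open>z\<close> but not on the jump, so the two moment constraints bound the sum by
    \<open>a + b\<close>, which is the second difference for jumps of size 1.\<close>
  have generator: "(\<Sum>i<n. Q i f z - f z) \<le> avg_shift 1 f z - f z" for z
  proof -
    obtain a b where ab: "a \<ge> 0" "b \<ge> 0" "a + b = (\<bar>z + 1\<bar> powr p + \<bar>z - 1\<bar> powr p) / 2 - \<bar>z\<bar> powr p"
      "\<And>x. (\<bar>z + x\<bar> powr p + \<bar>z - x\<bar> powr p) / 2 - \<bar>z\<bar> powr p \<le> a * x\<^sup>2 + b * \<bar>x\<bar> powr p"
      using second_difference_tangent[OF p, of z] by blast
    have "Q i f z - f z \<le> a * (\<Sum>x\<in>F i. w i x * x\<^sup>2) + b * (\<Sum>x\<in>F i. w i x * \<bar>x\<bar> powr p)" for i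
    proof -
      have "Q i f z - f z = (\<Sum>x\<in>F i. w i x * avg_shift x f z) - (\<Sum>x\<in>F i. w i x) * f z"
        using F(3)[of i] by (simp add: Q_def sym_op_def)
      also have "\<dots> = (\<Sum>x\<in>F i. w i x * (avg_shift x f z - f z))"
        by (simp add: sum_distrib_right sum_subtractf right_diff_distrib)
      also have "\<dots> \<le> (\<Sum>x\<in>F i. w i x * (a * x\<^sup>2 + b * \<bar>x\<bar> powr p))"
        using ab(4) F(2) by (intro sum_mono mult_left_mono) (auto simp: avg_shift_def f_def)
      also have "\<dots> = a * (\<Sum>x\<in>F i. w i x * x\<^sup>2) + b * (\<Sum>x\<in>F i. w i x * \<bar>x\<bar> powr p)"
        by (simp add: sum_distrib_left sum.distrib algebra_simps)
      finally show ?thesis .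
    qed
    then have "(\<Sum>i<n. Q i f z - f z)
        \<le> (\<Sum>i<n. a * (\<Sum>x\<in>F i. w i x * x\<^sup>2) + b * (\<Sum>x\<in>F i. w i x * \<bar>x\<bar> powr p))"
      by (intro sum_mono)
    also have "\<dots> = a * (\<Sum>i<n. \<Sum>x\<in>F i. w i x * x\<^sup>2) + b * (\<Sum>i<n. \<Sum>x\<in>F i. w i x * \<bar>x\<bar> powr p)"
      by (simp add: sum.distrib sum_distrib_left)
    also have "\<dots> \<le> a * 1 + b * 1"
      using ab(1,2) second pth by (intro add_mono mult_left_mono) auto
    finally show ?thesis using ab(3) by (simp add: avg_shift_def f_def)
  qed
  obtain C where C: "C \<ge> 0" and expansion: "\<And>s z. 0 \<le> s \<Longrightarrow> s \<le> 1 \<Longrightarrow>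
    op_prod (\<lambda>i. lazy_op s (Q i)) n f z \<le> f z + s * (\<Sum>i<n. Q i f z - f z) + s\<^sup>2 * C * cosh z"
    using op_prod_lazy_expansion[of Q k f, OF Q Q_cosh k f] by meson
  \<comment> \<open>Dominates the growth rates on \<open>cosh\<close> of both \<open>R\<close> and
    \<open>P\<close>, so that the single factor \<open>t = exp (s * c)\<close> serves for both, with
    \<open>t ^ m = exp c\<close> for every \<open>m\<close>.\<close>
  define c where "c = (\<Sum>i<n. k i - 1) + (cosh 1 - 1)"
  have c: "(\<Sum>i<n. k i - 1) \<le> c" "cosh 1 - 1 \<le> c" "c \<ge> 0"
    using sum_nonneg[of "{..<n}" "\<lambda>i. k i - 1"] k cosh_real_ge_1[of 1] by (auto simp: c_def)
  have "op_prod Q n f 0 \<le> (lazy_op (1 / real m) (avg_shift 1) ^^ m) f 0 + (C * exp c) / real m"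
    if m: "m \<ge> 1" for m
  proof -
    define s where "s = 1 / real m"
    have s: "0 \<le> s" "s \<le> 1" "real m * s = 1" using m by (auto simp: s_def)
    have L: "trans_op (lazy_op s (Q i))" for i by (rule trans_op_lazy_op[OF Q s(1,2)])
    define R where "R = op_prod (\<lambda>i. lazy_op s (Q i)) n"
    define P where "P = lazy_op s (avg_shift 1)"
    have R: "trans_op R" unfolding R_def by (rule trans_op_op_prod[where Q = "\<lambda>i. lazy_op s (Q i)", OF L])
    have P: "trans_op P" unfolding P_def by (rule trans_op_lazy_op[OF E s(1,2)])
    define t where "t = exp (s * c)"
    have t: "t \<ge> 1" using s c by (simp add: t_def)
    have tm: "t ^ m = exp c"
      using s(3) by (simp add: t_def exp_of_nat_mult[symmetric] mult.assoc[symmetric])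
    have "Q i f z \<le> (lazy_op s (Q i) ^^ m) f z" for i z
      using lazy_op_bernoulli[OF Q s(1,2), of i f z m] Q_convex s(3) by simp
    then have "op_prod Q n f 0 \<le> op_prod (\<lambda>i. lazy_op s (Q i) ^^ m) n f 0"
      by (intro op_prod_mono[where R = "\<lambda>i. lazy_op s (Q i) ^^ m"] Q trans_op_funpow L)
    also have "\<dots> = (R ^^ m) f 0"
      unfolding R_def by (simp add: op_prod_funpow[where Q = "\<lambda>i. lazy_op s (Q i)", OF L])
    also have "(R ^^ m) f 0 \<le> (P ^^ m) f 0 + s\<^sup>2 * C * real m * t ^ m * cosh 0"
    proof (rule funpow_trans_op_perturb[OF R P t])
      show "0 \<le> s\<^sup>2 * C" using C by simp
      fix z :: real
      have "R cosh z \<le> exp (s * (\<Sum>i<n. k i - 1)) * cosh z"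
        unfolding R_def by (rule op_prod_lazy_cosh[of Q k, OF Q Q_cosh k s(1,2)])
      also have "\<dots> \<le> t * cosh z"
        using s c(1) by (intro mult_right_mono) (auto simp: t_def mult_left_mono)
      finally show "R cosh z \<le> t * cosh z" .
      have "P cosh z = (1 + s * (cosh 1 - 1)) * cosh z"
        by (simp add: P_def lazy_op_def avg_shift_cosh algebra_simps)
      also have "\<dots> \<le> exp (s * (cosh 1 - 1)) * cosh z"
        by (intro mult_right_mono exp_ge_add_one_self) auto
      also have "\<dots> \<le> t * cosh z"
        using s c(2) by (intro mult_right_mono) (auto simp: t_def mult_left_mono)
      finally show "P cosh z \<le> t * cosh z" .
      have "R f z \<le> f z + s * (\<Sum>i<n. Q i f z - f z) + s\<^sup>2 * C * cosh z"
        unfolding R_def by (rule expansion[OF s(1,2)])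
      also have "\<dots> \<le> f z + s * (avg_shift 1 f z - f z) + s\<^sup>2 * C * cosh z"
        using generator[of z] s C by (intro add_mono mult_left_mono) auto
      also have "\<dots> = P f z + s\<^sup>2 * C * cosh z"
        by (simp add: P_def lazy_op_def algebra_simps)
      finally show "R f z \<le> P f z + s\<^sup>2 * C * cosh z" .
    qed
    also have "s\<^sup>2 * C * real m * t ^ m * cosh 0 = (C * exp c) / real m"
      using m by (simp add: tm s_def power2_eq_square)
    finally show ?thesis by (simp add: P_def s_def)
  qed
  then show ?thesis unfolding Q_def by blast
qed

section \<open>Smoothness and the Poisson limit\<close>

lemma summable_powr_over_fact:
  assumes "q > 0"
  shows "summable (\<lambda>n. (real n + 1) powr q / fact n)"
proof -
  have "summable (\<lambda>n. (2 * q powr q * exp 1) * (inverse (fact n) * exp 1 ^ n))"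
    by (intro summable_mult summable_exp)
  moreover have "norm ((real n + 1) powr q / fact n) \<le> (2 * q powr q * exp 1) * (inverse (fact n) * exp 1 ^ n)" for n
  proof -
    have "cosh (real n + 1) \<le> exp (real n + 1)"
      by (simp add: cosh_def)
    then have "(real n + 1) powr q \<le> 2 * q powr q * exp (real n + 1)"
      using abs_powr_le_cosh[OF assms, of "real n + 1"]
        mult_left_mono[of "cosh (real n + 1)" "exp (real n + 1)" "2 * q powr q"] by simp
    also have "exp (real n + 1) = exp 1 * exp 1 ^ n"
      by (simp add: exp_add exp_of_nat_mult[symmetric] mult.commute)
    finally show ?thesis by (simp add: field_simps)
  qed
  ultimately show ?thesis by (rule summable_comparison_test'[where N = 0])
qed

text \<open>Integrality keeps \<open>\<bar>x\<bar>\<close> away from the logarithmic singularity: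
  either \<open>x = 0\<close>, where \<open>powr\<close> gives 0, or \<open>ln \<bar>x\<bar>\<close>
  lies between 0 and \<open>\<bar>x\<bar>\<close> and costs \<open>j\<close> extra powers. The bound
  is uniform in \<open>p\<close> up to \<open>b\<close>, as the M-test requires.\<close>

lemma lattice_powr_ln_bound:
  assumes "real_of_int i = x" "\<bar>x\<bar> \<le> real n + 1" "0 < p" "p \<le> b"
  shows "\<bar>ln \<bar>x\<bar> ^ j * \<bar>x\<bar> powr p\<bar> \<le> (real n + 1) powr (b + real j)"
proof (cases "x = 0")
  case False
  then have x: "\<bar>x\<bar> \<ge> 1" using assms(1) by auto
  have ln: "0 \<le> ln \<bar>x\<bar>" "ln \<bar>x\<bar> \<le> \<bar>x\<bar>"
    using x False ln_le_minus_one[of "\<bar>x\<bar>"] by auto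
  have "\<bar>ln \<bar>x\<bar> ^ j * \<bar>x\<bar> powr p\<bar> = ln \<bar>x\<bar> ^ j * \<bar>x\<bar> powr p"
    using ln by simp
  also have "\<dots> \<le> (real n + 1) ^ j * (real n + 1) powr b"
  proof (intro mult_mono power_mono)
    have "\<bar>x\<bar> powr p \<le> (real n + 1) powr p"
      using assms by (intro powr_mono2) auto
    also have "\<dots> \<le> (real n + 1) powr b"
      using assms by (intro powr_mono) auto
    finally show "\<bar>x\<bar> powr p \<le> (real n + 1) powr b" .
  qed (use ln assms(2) in auto)
  also have "\<dots> = (real n + 1) powr (b + real j)"
    by (simp add: powr_add powr_realpow)
  finally show ?thesis .
qed simp

text \<open>For nonzero \<open>a\<close> this differentiates \<open>exp (p * ln a)\<close>; for
  \<open>a = 0\<close> both sides are identically 0 by the convention for \<open>powr\<close>. The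
  series below contain such zero bases.\<close>

lemma DERIV_powr_exponent:
  "((\<lambda>p. ln a ^ j * a powr p) has_real_derivative ln a ^ Suc j * a powr p) (at p)"
proof (cases "a = 0")
  case False
  then show ?thesis
    unfolding powr_def by (auto intro!: derivative_eq_intros)
qed simp

text \<open>The iterated derivatives of \<open>f\<close> are identified with the chain
  \<open>F\<close> by induction. They agree only on \<open>U\<close>, and openness is what transfers
  a derivative at a point from one to the other.\<close>

lemma infinitely_differentiable_onI:
  fixes F :: "nat \<Rightarrow> real \<Rightarrow> real"
  assumes "open U" and F: "\<And>j x. x \<in> U \<Longrightarrow> (F j has_real_derivative F (Suc j) x) (at x)"
    and f: "\<And>x. x \<in> U \<Longrightarrow> f x = F 0 x"
  shows "infinitely_differentiable_on f U"
proof -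
  have eq: "\<forall>x\<in>U. (deriv ^^ k) f x = F k x \<and> ((deriv ^^ k) f has_real_derivative F (Suc k) x) (at x)" for k
  proof (induction k)
    case 0
    have "(f has_real_derivative F (Suc 0) x) (at x)" if "x \<in> U" for x
      using F[OF that, of 0] has_field_derivative_transform_within_open[of "F 0" _ x U f] assms that by auto
    then show ?case using f by simp
  next
    case (Suc k)
    then have d: "(deriv ^^ Suc k) f x = F (Suc k) x" if "x \<in> U" for x
      using that by (auto intro: DERIV_imp_deriv)
    have "((deriv ^^ Suc k) f has_real_derivative F (Suc (Suc k)) x) (at x)" if "x \<in> U" for x
      using F[OF that, of "Suc k"] \<open>open U\<close> that d[symmetric]
      by (rule has_field_derivative_transform_within_open)
    then show ?case using d by blast
  qed
  then show ?thesis
    unfolding infinitely_differentiable_on_def field_differentiable_def by blast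
qed

text \<open>Here \<open>g j n\<close> is the \<open>j\<close>-th derivative of the
  \<open>n\<close>-th term. The majorant may grow with \<open>b\<close>, since termwise
  differentiation is local: at \<open>x\<close> the M-test is applied on the interval from 0 to
  \<open>x + 1\<close>.\<close>

lemma infinitely_differentiable_on_series:
  fixes g :: "nat \<Rightarrow> nat \<Rightarrow> real \<Rightarrow> real"
  assumes U: "open U" "U \<subseteq> {0<..}"
    and der: "\<And>j n x. (g j n has_real_derivative g (Suc j) n x) (at x)"
    and bound: "\<And>j n x b. 0 < x \<Longrightarrow> x \<le> b \<Longrightarrow> \<bar>g j n x\<bar> \<le> M b j n"
    and M: "\<And>b j. 0 < b \<Longrightarrow> summable (M b j)"
    and f: "\<And>x. x \<in> U \<Longrightarrow> f x = (\<Sum>n. g 0 n x)"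
  shows "infinitely_differentiable_on f U"
proof (rule infinitely_differentiable_onI[where F = "\<lambda>j x. \<Sum>n. g j n x", OF U(1) _ f])
  fix j x assume "x \<in> U"
  then have x: "x > 0" using U by auto
  let ?S = "{0<..<x + 1}"
  show "((\<lambda>x. \<Sum>n. g j n x) has_real_derivative (\<Sum>n. g (Suc j) n x)) (at x)"
  proof (rule has_field_derivative_series'(2)[of ?S "g j" "g (Suc j)"])
    show "uniformly_convergent_on ?S (\<lambda>n x. \<Sum>i<n. g (Suc j) i x)"
    proof (rule Weierstrass_m_test'[of _ _ "M (x + 1) (Suc j)"])
      show "norm (g (Suc j) n y) \<le> M (x + 1) (Suc j) n" if "y \<in> ?S" for n y
        using bound[of y "x + 1" "Suc j" n] that by auto
      show "summable (M (x + 1) (Suc j))" using M x by auto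
    qed
    show "summable (\<lambda>n. g j n x)"
    proof (rule summable_comparison_test'[of "M (x + 1) j" 0])
      show "summable (M (x + 1) j)" using M x by auto
      show "norm (g j n x) \<le> M (x + 1) j n" for n
        using bound[of x "x + 1" j n] x by auto
    qed
    show "x \<in> interior ?S" using x by (simp add: interior_open)
    show "(g j n has_real_derivative g (Suc j) n y) (at y within ?S)" for n y
      by (rule has_field_derivative_at_within[OF der])
  qed (use x in auto)
qed

lemma infinitely_differentiable_poisson_L: "infinitely_differentiable_on poisson_L {4<..}"
proof (rule infinitely_differentiable_on_series
    [where g = "\<lambda>j n p. exp (- 1) / fact n * (ln \<bar>real n - 1\<bar> ^ j * \<bar>real n - 1\<bar> powr p)"
       and M = "\<lambda>b j n. exp (- 1) * ((real n + 1) powr (b + real j) / fact n)"])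
  show "summable (\<lambda>n. exp (- 1) * ((real n + 1) powr (b + real j) / fact n))" if "b > 0" for b j
    using that by (intro summable_mult summable_powr_over_fact) auto
  show "poisson_L p = (\<Sum>n. exp (- 1) / fact n * (ln \<bar>real n - 1\<bar> ^ 0 * \<bar>real n - 1\<bar> powr p))" if "p \<in> {4<..}" for p
    using that poisson_L_series[of p] suminf_mult[OF poisson_L_series(1)[of p], of "exp (- 1)"] by simp
  show "\<bar>exp (- 1) / fact n * (ln \<bar>real n - 1\<bar> ^ j * \<bar>real n - 1\<bar> powr p)\<bar>
      \<le> exp (- 1) * ((real n + 1) powr (b + real j) / fact n)" if "0 < p" "p \<le> b" for j n p b
    using lattice_powr_ln_bound[of "int n - 1" "real n - 1" n p b j] that
    by (simp add: abs_mult divide_right_mono)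
  show "((\<lambda>p. exp (- 1) / fact n * (ln \<bar>real n - 1\<bar> ^ j * \<bar>real n - 1\<bar> powr p)) has_real_derivative
      exp (- 1) / fact n * (ln \<bar>real n - 1\<bar> ^ Suc j * \<bar>real n - 1\<bar> powr p)) (at p)" for j n p
    by (intro DERIV_cmult DERIV_powr_exponent)
qed auto

text \<open>The \<open>p\<close>-th absolute moment of a simple random walk stopped at an independent Poisson(1) time,
  that is, of the difference of two independent Poisson(1/2) variables.\<close>

definition sym_poisson_moment :: "real \<Rightarrow> real" where
  "sym_poisson_moment p = (\<Sum>n. exp (- 1) / fact n * (avg_shift 1 ^^ n) (\<lambda>x. \<bar>x\<bar> powr p) 0)"

text \<open>A walk of \<open>n\<close> unit steps from an integer \<open>k\<close> only visits
  integers of modulus at most \<open>\<bar>k\<bar> + n\<close>, so bounds on the lattice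
  suffice.\<close>

lemma avg_shift_funpow_bound:
  assumes "\<And>i. \<bar>i\<bar> \<le> \<bar>k\<bar> + int n \<Longrightarrow> \<bar>h (real_of_int i)\<bar> \<le> B"
  shows "\<bar>(avg_shift 1 ^^ n) h (real_of_int k)\<bar> \<le> B"
  using assms
proof (induction n arbitrary: k)
  case 0
  then show ?case by simp
next
  case (Suc n)
  have "\<bar>(avg_shift 1 ^^ n) h (real_of_int (k + 1))\<bar> \<le> B"
    by (rule Suc.IH) (use Suc.prems in auto)
  moreover have "\<bar>(avg_shift 1 ^^ n) h (real_of_int (k - 1))\<bar> \<le> B"
    by (rule Suc.IH) (use Suc.prems in auto)
  ultimately show ?case
    by (simp add: avg_shift_def[of 1 "(avg_shift 1 ^^ n) h"] abs_le_iff)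
qed

lemma avg_shift_funpow_abs_powr_bound:
  assumes "0 < p" "p \<le> b"
  shows "\<bar>(avg_shift 1 ^^ n) (\<lambda>x. ln \<bar>x\<bar> ^ j * \<bar>x\<bar> powr p) 0\<bar> \<le> (real n + 1) powr (b + real j)"
proof -
  have "\<bar>(avg_shift 1 ^^ n) (\<lambda>x. ln \<bar>x\<bar> ^ j * \<bar>x\<bar> powr p) (real_of_int 0)\<bar> \<le> (real n + 1) powr (b + real j)"
  proof (rule avg_shift_funpow_bound)
    fix i assume "\<bar>i\<bar> \<le> \<bar>0\<bar> + int n"
    then have "\<bar>real_of_int i\<bar> \<le> real n + 1" by linarith
    then show "\<bar>ln \<bar>real_of_int i\<bar> ^ j * \<bar>real_of_int i\<bar> powr p\<bar> \<le> (real n + 1) powr (b + real j)"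
      using assms by (intro lattice_powr_ln_bound[of i]) auto
  qed
  then show ?thesis by simp
qed

lemma DERIV_avg_shift_funpow:
  assumes "\<And>x p. ((\<lambda>p. h p x) has_real_derivative h' p x) (at p)"
  shows "((\<lambda>p. (avg_shift 1 ^^ n) (h p) z) has_real_derivative (avg_shift 1 ^^ n) (h' p) z) (at p)"
proof (induction n arbitrary: z)
  case 0
  then show ?case using assms by simp
next
  case (Suc n)
  show ?case
    using DERIV_cdivide[OF DERIV_add[OF Suc[of "z + 1"] Suc[of "z - 1"]], of 2]
    by (simp add: avg_shift_def[of 1 "(avg_shift 1 ^^ n) g" for g])
qed

lemma infinitely_differentiable_sym_poisson_moment:
  "infinitely_differentiable_on sym_poisson_moment {4<..}"
proof (rule infinitely_differentiable_on_series
    [where g = "\<lambda>j n p. exp (- 1) / fact n * (avg_shift 1 ^^ n) (\<lambda>x. ln \<bar>x\<bar> ^ j * \<bar>x\<bar> powr p) 0"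
       and M = "\<lambda>b j n. exp (- 1) * ((real n + 1) powr (b + real j) / fact n)"])
  show "summable (\<lambda>n. exp (- 1) * ((real n + 1) powr (b + real j) / fact n))" if "b > 0" for b j
    using that by (intro summable_mult summable_powr_over_fact) auto
  show "\<bar>exp (- 1) / fact n * (avg_shift 1 ^^ n) (\<lambda>x. ln \<bar>x\<bar> ^ j * \<bar>x\<bar> powr p) 0\<bar>
      \<le> exp (- 1) * ((real n + 1) powr (b + real j) / fact n)" if "0 < p" "p \<le> b" for j n p b
    using avg_shift_funpow_abs_powr_bound[OF that, of n j]
    by (simp add: abs_mult divide_right_mono)
  show "((\<lambda>p. exp (- 1) / fact n * (avg_shift 1 ^^ n) (\<lambda>x. ln \<bar>x\<bar> ^ j * \<bar>x\<bar> powr p) 0) has_real_derivative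
      exp (- 1) / fact n * (avg_shift 1 ^^ n) (\<lambda>x. ln \<bar>x\<bar> ^ Suc j * \<bar>x\<bar> powr p) 0) (at p)" for j n p
    by (intro DERIV_cmult DERIV_avg_shift_funpow DERIV_powr_exponent)
qed (auto simp: sym_poisson_moment_def)

section \<open>Poisson limit of binomial mixtures\<close>

text \<open>Pascal's rule, in the form of the induction step of the binomial theorem with
  \<open>g k\<close> in place of the \<open>k\<close>-th power of an operator.\<close>

lemma binomial_sum_Suc:
  fixes s r :: real
  shows "(\<Sum>k\<le>m. real (m choose k) * s ^ k * r ^ (m - k) * (r * g k + s * g (Suc k)))
    = (\<Sum>k\<le>Suc m. real (Suc m choose k) * s ^ k * r ^ (Suc m - k) * g k)"
proof -
  \<comment> \<open>The added term \<open>k = Suc m\<close> is 0 because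
    \<open>m choose Suc m\<close> is.\<close>
  have "(\<Sum>k\<le>m. real (m choose k) * s ^ k * r ^ Suc (m - k) * g k)
      = (\<Sum>k\<le>Suc m. real (m choose k) * s ^ k * r ^ (Suc m - k) * g k)"
    by (simp add: Suc_diff_le)
  also have "\<dots> = r ^ Suc m * g 0
      + (\<Sum>k\<le>m. real (m choose Suc k) * s ^ Suc k * r ^ (m - k) * g (Suc k))"
    by (subst sum.atMost_Suc_shift) simp
  finally have 1: "(\<Sum>k\<le>m. real (m choose k) * s ^ k * r ^ Suc (m - k) * g k) = \<dots>" .
  have "(\<Sum>k\<le>Suc m. real (Suc m choose k) * s ^ k * r ^ (Suc m - k) * g k) = r ^ Suc m * g 0
      + (\<Sum>k\<le>m. real (Suc m choose Suc k) * s ^ Suc k * r ^ (m - k) * g (Suc k))"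
    by (subst sum.atMost_Suc_shift) simp
  also have "\<dots> = (\<Sum>k\<le>m. real (m choose k) * s ^ k * r ^ Suc (m - k) * g k)
      + (\<Sum>k\<le>m. real (m choose k) * s ^ Suc k * r ^ (m - k) * g (Suc k))"
    unfolding 1 by (simp add: sum.distrib[symmetric] algebra_simps)
  also have "\<dots> = (\<Sum>k\<le>m. real (m choose k) * s ^ k * r ^ (m - k) * (r * g k + s * g (Suc k)))"
    by (simp add: sum.distrib[symmetric] algebra_simps)
  finally show ?thesis by simp
qed

text \<open>Probabilistically, the number of genuine steps among \<open>m\<close> lazy ones has the
  binomial law with parameters \<open>m\<close> and \<open>s\<close>.\<close>

lemma lazy_op_funpow_binomial:
  assumes Q: "trans_op Q" and s: "0 \<le> s" "s \<le> 1"
  shows "(lazy_op s Q ^^ m) f z = (\<Sum>k\<le>m. real (m choose k) * s ^ k * (1 - s) ^ (m - k) * (Q ^^ k) f z)"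
proof (induction m arbitrary: z)
  case 0
  then show ?case by simp
next
  case (Suc m)
  define c where "c = (\<lambda>k. real (m choose k) * s ^ k * (1 - s) ^ (m - k))"
  have "(lazy_op s Q ^^ m) f = (\<lambda>z. \<Sum>k\<le>m. c k * (Q ^^ k) f z)"
    using Suc by (auto simp: c_def)
  moreover have "Q (\<lambda>z. \<Sum>k\<le>m. c k * (Q ^^ k) f z) = (\<lambda>z. \<Sum>k\<le>m. c k * Q ((Q ^^ k) f) z)"
    by (simp only: trans_op_sum_arg[OF Q finite_atMost] trans_op_cmult[OF Q])
  ultimately have "lazy_op s Q ((lazy_op s Q ^^ m) f) z
      = (\<Sum>k\<le>m. c k * ((1 - s) * (Q ^^ k) f z + s * (Q ^^ Suc k) f z))"
    by (simp add: lazy_op_def sum_distrib_left sum.distrib[symmetric] distrib_left mult.left_commute)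
  also have "\<dots> = (\<Sum>k\<le>Suc m. real (Suc m choose k) * s ^ k * (1 - s) ^ (Suc m - k) * (Q ^^ k) f z)"
    unfolding c_def
    by (rule binomial_sum_Suc)
  finally show ?case by simp
qed

lemma binomial_over_power_tendsto:
  "(\<lambda>m. real (m choose k) / real m ^ k) \<longlonglongrightarrow> 1 / fact k"
proof -
  have "(\<lambda>m. (\<Prod>i<k. 1 - real i / real m) / fact k) \<longlonglongrightarrow> (\<Prod>i<k. 1 - 0) / fact k"
    by (intro tendsto_intros tendsto_divide_0[OF tendsto_const] filterlim_real_at_infinity_sequentially) auto
  moreover have "\<forall>\<^sub>F m in sequentially. (\<Prod>i<k. 1 - real i / real m) / fact k = real (m choose k) / real m ^ k"
    using eventually_gt_at_top[of 0]
  proof eventually_elim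
    case (elim m)
    have "(\<Prod>i<k. 1 - real i / real m) = (\<Prod>i<k. (real m - real i) / real m)"
      using elim by (intro prod.cong) (auto simp: field_simps)
    also have "\<dots> = (\<Prod>i<k. real m - real i) / real m ^ k"
      by (simp add: prod_dividef)
    finally show ?case
      by (simp add: binomial_gbinomial gbinomial_prod_rev atLeast0LessThan)
  qed
  ultimately show ?thesis by (simp add: filterlim_cong)
qed

text \<open>The law of small numbers tested against a possibly unbounded \<open>g\<close>. Tannery's
  theorem applies with majorant \<open>\<bar>g k\<bar> / fact k\<close>, because
  \<open>m choose k\<close> is at most \<open>m ^ k / fact k\<close>.\<close>

lemma binomial_poisson_tendsto:
  fixes g :: "nat \<Rightarrow> real"
  assumes "summable (\<lambda>k. \<bar>g k\<bar> / fact k)"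
  shows "(\<lambda>m. \<Sum>k\<le>m. real (m choose k) * (1 / real m) ^ k * (1 - 1 / real m) ^ (m - k) * g k)
    \<longlonglongrightarrow> (\<Sum>k. exp (- 1) / fact k * g k)"
proof -
  define a where "a = (\<lambda>k m. real (m choose k) * (1 / real m) ^ k * (1 - 1 / real m) ^ (m - k) * g k)"
  have "(\<lambda>m. \<Sum>k. a k m) \<longlonglongrightarrow> (\<Sum>k. exp (- 1) / fact k * g k)"
  proof (rule tannerys_theorem[THEN conjunct2, THEN conjunct2])
    fix k
    have inv: "(\<lambda>m. 1 - 1 / real m) \<longlonglongrightarrow> 1"
      using tendsto_diff[OF tendsto_const lim_1_over_n, of 1] by simp
    have "(\<lambda>m. (real (m choose k) / real m ^ k) * ((1 + (-1) / real m) ^ m / (1 - 1 / real m) ^ k) * g k)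
        \<longlonglongrightarrow> 1 / fact k * (exp (- 1) / 1 ^ k) * g k"
      by (intro tendsto_intros binomial_over_power_tendsto tendsto_exp_limit_sequentially inv) auto
    moreover have "\<forall>\<^sub>F m in sequentially.
        (real (m choose k) / real m ^ k) * ((1 + (-1) / real m) ^ m / (1 - 1 / real m) ^ k) * g k = a k m"
      \<comment> \<open>Ensures \<open>k \<le> m\<close> and a nonzero base, so that the power with
        exponent \<open>m - k\<close> splits as a quotient.\<close>
      using eventually_gt_at_top[of "k + 1"]
    proof eventually_elim
      case (elim m)
      then have "(1 - 1 / real m) ^ (m - k) = (1 - 1 / real m) ^ m / (1 - 1 / real m) ^ k"
        by (intro power_diff) auto
      then show ?case by (simp add: a_def power_divide)
    qed
    ultimately show "a k \<longlonglongrightarrow> exp (- 1) / fact k * g k"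
      by (simp add: filterlim_cong)
  next
    have "norm (a k m) \<le> \<bar>g k\<bar> / fact k" if "m \<ge> 1" for k m
    proof -
      have "(m choose k) * fact k \<le> m ^ k"
        by (rule binomial_fact_pow)
      then have "real (m choose k) * fact k \<le> real m ^ k"
        by (metis of_nat_fact of_nat_le_iff of_nat_mult of_nat_power)
      then have "real (m choose k) * (1 / real m) ^ k \<le> 1 / fact k"
        using that by (simp add: field_simps power_divide)
      moreover have "(1 - 1 / real m) ^ (m - k) \<le> 1" "(1 - 1 / real m) ^ (m - k) \<ge> 0"
        using that by (auto intro!: power_le_one)
      ultimately have "real (m choose k) * (1 / real m) ^ k * (1 - 1 / real m) ^ (m - k) \<le> 1 / fact k * 1"
        by (intro mult_mono) auto
      then have "real (m choose k) * (1 / real m) ^ k * (1 - 1 / real m) ^ (m - k) * \<bar>g k\<bar> \<le> 1 / fact k * 1 * \<bar>g k\<bar>"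
        by (rule mult_right_mono) simp
      then show ?thesis
        using \<open>(1 - 1 / real m) ^ (m - k) \<ge> 0\<close> by (simp add: a_def abs_mult)
    qed
    then show "\<forall>\<^sub>F (k, m) in at_top \<times>\<^sub>F sequentially. norm (a k m) \<le> \<bar>g k\<bar> / fact k"
      unfolding eventually_prod_filter
      by (intro exI[of _ "\<lambda>_. True"] exI[of _ "\<lambda>m. m \<ge> 1"]) (auto simp: eventually_ge_at_top)
    show "summable (\<lambda>k. \<bar>g k\<bar> / fact k)" by (rule assms)
  qed simp
  moreover have "(\<Sum>k. a k m) = (\<Sum>k\<le>m. a k m)" for m
    by (rule suminf_finite) (auto simp: a_def)
  ultimately show ?thesis by (simp add: a_def)
qed

lemma lazy_walk_moment_tendsto:
  assumes "p > 4"
  shows "(\<lambda>m. (lazy_op (1 / real m) (avg_shift 1) ^^ m) (\<lambda>x. \<bar>x\<bar> powr p) 0) \<longlonglongrightarrow> sym_poisson_moment p"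
proof -
  define g where "g = (\<lambda>k. (avg_shift 1 ^^ k) (\<lambda>x. \<bar>x\<bar> powr p) 0)"
  have "\<bar>g k\<bar> \<le> (real k + 1) powr p" for k
    using avg_shift_funpow_abs_powr_bound[of p p k 0] assms by (simp add: g_def)
  then have "summable (\<lambda>k. \<bar>g k\<bar> / fact k)"
    using assms by (intro summable_comparison_test'[OF summable_powr_over_fact[of p], of 0])
      (auto simp: divide_right_mono)
  from binomial_poisson_tendsto[OF this]
  have "(\<lambda>m. \<Sum>k\<le>m. real (m choose k) * (1 / real m) ^ k * (1 - 1 / real m) ^ (m - k) * g k)
      \<longlonglongrightarrow> sym_poisson_moment p"
    unfolding sym_poisson_moment_def g_def .
  moreover have "\<forall>\<^sub>F m in sequentially.
      (\<Sum>k\<le>m. real (m choose k) * (1 / real m) ^ k * (1 - 1 / real m) ^ (m - k) * g k)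
      = (lazy_op (1 / real m) (avg_shift 1) ^^ m) (\<lambda>x. \<bar>x\<bar> powr p) 0"
    using eventually_gt_at_top[of 0]
    by eventually_elim (simp add: g_def lazy_op_funpow_binomial[OF trans_op_avg_shift])
  ultimately show ?thesis by (simp add: filterlim_cong)
qed

section \<open>The sharp Rosenthal constant\<close>

lemma trans_op_borel_measurable:
  assumes "trans_op Q" and [measurable]: "f \<in> borel_measurable borel"
  shows "Q f \<in> borel_measurable borel"
proof -
  obtain l where Q: "Q = conv_list l"
    using assms(1) by (rule trans_opE)
  have "(\<lambda>z. conv_list l f z) \<in> borel_measurable borel"
    by (induction l) simp_all
  then show ?thesis by (simp add: Q)
qed

section \<open>Expectations of sums of independent symmetric variables\<close>

lemma symmetrically_distributed_compose:
  assumes "symmetrically_distributed M X" and [measurable]: "X \<in> borel_measurable M" "h \<in> borel_measurable borel"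
    and odd: "\<And>x. h (- x) = - h x"
  shows "symmetrically_distributed M (\<lambda>\<omega>. h (X \<omega>))"
proof -
  have "distr M borel (\<lambda>\<omega>. h (X \<omega>)) = distr (distr M borel X) borel h"
    by (subst distr_distr) (auto simp: comp_def)
  also have "\<dots> = distr (distr M borel (\<lambda>\<omega>. - X \<omega>)) borel h"
    using assms(1) by (simp add: symmetrically_distributed_def)
  also have "\<dots> = distr M borel (\<lambda>\<omega>. - h (X \<omega>))"
    by (subst distr_distr) (auto simp: comp_def odd)
  finally show ?thesis by (simp add: symmetrically_distributed_def)
qed

lemma symmetrically_distributed_integral:
  fixes g :: "real \<Rightarrow> real"
  assumes "symmetrically_distributed M X" and [measurable]: "X \<in> borel_measurable M" "g \<in> borel_measurable borel"
  shows "(\<integral>\<omega>. g (X \<omega>) \<partial>M) = (\<integral>\<omega>. g (- X \<omega>) \<partial>M)"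
proof -
  have "(\<integral>\<omega>. g (X \<omega>) \<partial>M) = (\<integral>x. g x \<partial>distr M borel X)"
    by (subst integral_distr) auto
  also have "\<dots> = (\<integral>x. g x \<partial>distr M borel (\<lambda>\<omega>. - X \<omega>))"
    using assms(1) by (simp add: symmetrically_distributed_def)
  also have "\<dots> = (\<integral>\<omega>. g (- X \<omega>) \<partial>M)"
    by (subst integral_distr) auto
  finally show ?thesis .
qed

context prob_space
begin

abbreviation point_prob :: "('a \<Rightarrow> real) \<Rightarrow> real \<Rightarrow> real" where
  "point_prob Y x \<equiv> prob (Y -` {x} \<inter> space M)"

lemma expectation_finite_range:
  fixes Y :: "'a \<Rightarrow> real" and g :: "real \<Rightarrow> real"
  assumes [measurable]: "random_variable borel Y" "g \<in> borel_measurable borel"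
    and F: "finite F" "AE \<omega> in M. Y \<omega> \<in> F"
  shows "expectation (\<lambda>\<omega>. g (Y \<omega>)) = (\<Sum>x\<in>F. point_prob Y x * g x)"
proof -
  have [measurable]: "Y -` {x} \<inter> space M \<in> events" for x
    by (rule measurable_sets[of _ _ borel]) auto
  have "expectation (\<lambda>\<omega>. g (Y \<omega>)) = expectation (\<lambda>\<omega>. \<Sum>x\<in>F. g x * indicator (Y -` {x} \<inter> space M) \<omega>)"
  proof (rule integral_cong_AE)
    show "AE \<omega> in M. g (Y \<omega>) = (\<Sum>x\<in>F. g x * indicator (Y -` {x} \<inter> space M) \<omega>)"
      using F(2) AE_space
    proof eventually_elim
      case (elim \<omega>)
      have "(\<Sum>x\<in>F. g x * indicator (Y -` {x} \<inter> space M) \<omega>) = (\<Sum>x\<in>F. if x = Y \<omega> then g x else 0)"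
        using elim by (intro sum.cong) (auto simp: indicator_def)
      then show ?case using F(1) elim by simp
    qed
  qed auto
  also have "\<dots> = (\<Sum>x\<in>F. point_prob Y x * g x)"
    by (subst Bochner_Integration.integral_sum) (auto simp: mult.commute emeasure_eq_measure)
  finally show ?thesis .
qed

text \<open>Conditioning on the finitely many values of the last summand. Integrability is part of
  the induction because the product rule for independent variables demands it, and \<open>z\<close>
  is generalised because conditioning shifts the argument.\<close>

lemma expectation_sum_op_prod:
  fixes Y :: "nat \<Rightarrow> 'a \<Rightarrow> real" and f :: "real \<Rightarrow> real"
  assumes indep: "indep_vars (\<lambda>_. borel) Y UNIV"
    and sym: "\<And>i. symmetrically_distributed M (Y i)"
    and F: "\<And>i. finite (F i)" "\<And>i. AE \<omega> in M. Y i \<omega> \<in> F i"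
    and f [measurable]: "f \<in> borel_measurable borel"
  shows "integrable M (\<lambda>\<omega>. f (z + (\<Sum>i<n. Y i \<omega>))) \<and>
    expectation (\<lambda>\<omega>. f (z + (\<Sum>i<n. Y i \<omega>))) = op_prod (\<lambda>i. sym_op (F i) (point_prob (Y i))) n f z"
proof (induction n arbitrary: z)
  case 0
  then show ?case by (simp add: prob_space)
next
  case (Suc n)
  have rv [measurable]: "random_variable borel (Y i)" for i
    using indep by (auto simp: indep_vars_def)
  have [measurable]: "Y i -` {x} \<inter> space M \<in> events" for i x
    by (rule measurable_sets[of _ _ borel]) auto
  let ?Q = "\<lambda>i. sym_op (F i) (point_prob (Y i))"
  define h where "h = op_prod ?Q n f"
  have "trans_op (op_prod ?Q n)"
    by (rule trans_op_op_prod[where Q = ?Q]) (auto intro: trans_op_sym_op F)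
  then have h [measurable]: "h \<in> borel_measurable borel"
    unfolding h_def by (rule trans_op_borel_measurable) simp
  let ?S = "\<lambda>\<omega>. \<Sum>i<n. Y i \<omega>"
  have ind: "indep_var borel (Y n) borel ?S"
    by (rule indep_vars_sum) (auto intro: indep_vars_subset[OF indep])
  have summand: "integrable M (\<lambda>\<omega>. indicator {x} (Y n \<omega>) * f ((z + x) + ?S \<omega>)) \<and>
    expectation (\<lambda>\<omega>. indicator {x} (Y n \<omega>) * f ((z + x) + ?S \<omega>)) = point_prob (Y n) x * h (z + x)" for x
  proof -
    have "indep_var borel (indicator {x} \<circ> Y n) borel ((\<lambda>s. f ((z + x) + s)) \<circ> ?S)"
      by (rule indep_var_compose[OF ind]) auto
    then have iv: "indep_var borel (\<lambda>\<omega>. indicator {x} (Y n \<omega>) :: real) borel (\<lambda>\<omega>. f ((z + x) + ?S \<omega>))"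
      by (simp add: comp_def)
    have i1: "integrable M (\<lambda>\<omega>. indicator {x} (Y n \<omega>) :: real)"
      by (rule integrable_const_bound[of _ 1]) (auto simp: indicator_def)
    have i2: "integrable M (\<lambda>\<omega>. f ((z + x) + ?S \<omega>))"
      using Suc by blast
    have "expectation (\<lambda>\<omega>. indicator {x} (Y n \<omega>)) = point_prob (Y n) x"
    proof -
      have "expectation (\<lambda>\<omega>. indicat_real {x} (Y n \<omega>)) = expectation (indicat_real (Y n -` {x} \<inter> space M))"
        by (rule Bochner_Integration.integral_cong) (auto simp: indicator_def)
      then show ?thesis by simp
    qed
    then show ?thesis
      using indep_var_integrable[OF iv i1 i2] indep_var_lebesgue_integral[OF iv i1 i2] Suc[of "z + x"]
      by (simp add: h_def)
  qed
  have AE: "AE \<omega> in M. f (z + (\<Sum>i<Suc n. Y i \<omega>)) = (\<Sum>x\<in>F n. indicator {x} (Y n \<omega>) * f ((z + x) + ?S \<omega>))"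
    using F(2)[of n]
  proof eventually_elim
    case (elim \<omega>)
    have "(\<Sum>x\<in>F n. indicator {x} (Y n \<omega>) * f ((z + x) + ?S \<omega>))
        = (\<Sum>x\<in>F n. if x = Y n \<omega> then f ((z + x) + ?S \<omega>) else 0)"
      by (intro sum.cong) (auto simp: indicator_def)
    then show ?case using elim F(1) by (simp add: add_ac)
  qed
  have int: "integrable M (\<lambda>\<omega>. f (z + (\<Sum>i<Suc n. Y i \<omega>)))"
    by (subst integrable_cong_AE[OF _ _ AE]) (use summand in auto)
  have "expectation (\<lambda>\<omega>. f (z + (\<Sum>i<Suc n. Y i \<omega>)))
      = expectation (\<lambda>\<omega>. \<Sum>x\<in>F n. indicator {x} (Y n \<omega>) * f ((z + x) + ?S \<omega>))"
    by (rule integral_cong_AE[OF _ _ AE]) auto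
  also have "\<dots> = (\<Sum>x\<in>F n. point_prob (Y n) x * h (z + x))"
    using summand by (subst Bochner_Integration.integral_sum) auto
  also have "\<dots> = (\<Sum>x\<in>F n. point_prob (Y n) x * avg_shift x h z)"
  proof -
    \<comment> \<open>By symmetry the expectations at \<open>z + Y n \<omega>\<close> and
      \<open>z - Y n \<omega>\<close> coincide, so each equals their mean, which is how
      \<open>avg_shift\<close> arises.\<close>
    have "(\<Sum>x\<in>F n. point_prob (Y n) x * h (z + x)) = expectation (\<lambda>\<omega>. h (z + Y n \<omega>))"
      by (rule expectation_finite_range[symmetric, OF rv _ F]) simp
    also have "\<dots> = expectation (\<lambda>\<omega>. h (z - Y n \<omega>))"
      using symmetrically_distributed_integral[OF sym rv, of "\<lambda>y. h (z + y)"] by simp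
    also have "\<dots> = (\<Sum>x\<in>F n. point_prob (Y n) x * h (z - x))"
      by (rule expectation_finite_range[OF rv _ F]) simp
    finally have "(\<Sum>x\<in>F n. point_prob (Y n) x * h (z + x))
        = ((\<Sum>x\<in>F n. point_prob (Y n) x * h (z + x)) + (\<Sum>x\<in>F n. point_prob (Y n) x * h (z - x))) / 2"
      by simp
    then show ?thesis
      by (simp add: avg_shift_def sum.distrib[symmetric] sum_divide_distrib distrib_left)
  qed
  also have "\<dots> = op_prod ?Q (Suc n) f z"
    by (simp add: sym_op_def h_def)
  finally show ?case using int by blast
qed

text \<open>The operator comparison for fixed \<open>n\<close>, with \<open>m\<close> tending to
  infinity: the error \<open>C / m\<close> disappears and the lazy walk moment tends to the Poisson
  moment.\<close>

lemma rosenthal_finite_range: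
  fixes Y :: "nat \<Rightarrow> 'a \<Rightarrow> real"
  assumes p: "p > 4" and indep: "indep_vars (\<lambda>_. borel) Y UNIV"
    and sym: "\<And>i. symmetrically_distributed M (Y i)"
    and F: "\<And>i. finite (F i)" "\<And>i. AE \<omega> in M. Y i \<omega> \<in> F i"
    and second: "(\<Sum>i<n. expectation (\<lambda>\<omega>. (Y i \<omega>)\<^sup>2)) \<le> 1"
    and pth: "(\<Sum>i<n. expectation (\<lambda>\<omega>. \<bar>Y i \<omega>\<bar> powr p)) \<le> 1"
  shows "expectation (\<lambda>\<omega>. \<bar>\<Sum>i<n. Y i \<omega>\<bar> powr p) \<le> sym_poisson_moment p"
proof -
  have rv: "random_variable borel (Y i)" for i
    using indep by (auto simp: indep_vars_def)
  have fin: "expectation (\<lambda>\<omega>. g (Y i \<omega>)) = (\<Sum>x\<in>F i. point_prob (Y i) x * g x)"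
    if "g \<in> borel_measurable borel" for g :: "real \<Rightarrow> real" and i
    by (rule expectation_finite_range[OF rv that F])
  have "(\<Sum>x\<in>F i. point_prob (Y i) x) = 1" for i
    using fin[of "\<lambda>_. 1" i] by (simp add: prob_space)
  moreover have "(\<Sum>i<n. \<Sum>x\<in>F i. point_prob (Y i) x * x\<^sup>2) \<le> 1"
    using second fin[of "\<lambda>x. x\<^sup>2"] by simp
  moreover have "(\<Sum>i<n. \<Sum>x\<in>F i. point_prob (Y i) x * \<bar>x\<bar> powr p) \<le> 1"
    using pth fin[of "\<lambda>x. \<bar>x\<bar> powr p"] by simp
  ultimately obtain C where C: "\<And>m. m \<ge> 1 \<Longrightarrow>
      op_prod (\<lambda>i. sym_op (F i) (point_prob (Y i))) n (\<lambda>x. \<bar>x\<bar> powr p) 0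
      \<le> (lazy_op (1 / real m) (avg_shift 1) ^^ m) (\<lambda>x. \<bar>x\<bar> powr p) 0 + C / real m"
    using op_prod_le_lazy_funpow[OF p, of F "\<lambda>i. point_prob (Y i)" n] F(1) by auto
  have "(\<lambda>m. (lazy_op (1 / real m) (avg_shift 1) ^^ m) (\<lambda>x. \<bar>x\<bar> powr p) 0 + C / real m)
      \<longlonglongrightarrow> sym_poisson_moment p + 0"
    by (intro tendsto_add lazy_walk_moment_tendsto p lim_const_over_n)
  then have "op_prod (\<lambda>i. sym_op (F i) (point_prob (Y i))) n (\<lambda>x. \<bar>x\<bar> powr p) 0 \<le> sym_poisson_moment p + 0"
    by (rule LIMSEQ_le_const) (use C in blast)
  then show ?thesis
    using expectation_sum_op_prod[OF indep sym F, of "\<lambda>x. \<bar>x\<bar> powr p" 0 n] by simp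
qed

end

text \<open>Oddness keeps the rounded variables symmetric, rounding towards zero keeps both moment
  constraints.\<close>

definition odd_round :: "nat \<Rightarrow> real \<Rightarrow> real" where
  "odd_round k x = sgn x * (real_of_int \<lfloor>min \<bar>x\<bar> (real k) * real k\<rfloor> / real k)"

lemma odd_round_minus: "odd_round k (- x) = - odd_round k x"
  by (simp add: odd_round_def)

lemma odd_round_measurable [measurable]: "odd_round k \<in> borel_measurable borel"
  unfolding odd_round_def[abs_def] by measurable

lemma abs_odd_round:
  "\<bar>odd_round k x\<bar> = (if x = 0 then 0 else real_of_int \<lfloor>min \<bar>x\<bar> (real k) * real k\<rfloor> / real k)"
  by (auto simp: odd_round_def abs_mult abs_sgn_eq)

lemma abs_odd_round_le: "\<bar>odd_round k x\<bar> \<le> \<bar>x\<bar>"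
proof (cases "k = 0 \<or> x = 0")
  case False
  have "real_of_int \<lfloor>min \<bar>x\<bar> (real k) * real k\<rfloor> \<le> min \<bar>x\<bar> (real k) * real k"
    by (rule of_int_floor_le)
  also have "\<dots> \<le> \<bar>x\<bar> * real k"
    by (intro mult_right_mono) auto
  finally show ?thesis
    using False by (simp add: abs_odd_round field_simps)
qed (auto simp: odd_round_def)

text \<open>The grid is finite and depends on \<open>k\<close> alone, hence can serve as the common
  range of all rounded variables.\<close>

lemma odd_round_in_grid: "odd_round k x \<in> (\<lambda>j. real_of_int j / real k) ` {- (int k * int k)..int k * int k}"
proof -
  define j where "j = \<lfloor>min \<bar>x\<bar> (real k) * real k\<rfloor>"
  have "0 \<le> j" by (simp add: j_def)
  moreover have "min \<bar>x\<bar> (real k) * real k \<le> real k * real k"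
    by (intro mult_right_mono) auto
  then have "real_of_int j \<le> real k * real k"
    unfolding j_def using of_int_floor_le order_trans by blast
  then have "j \<le> int k * int k"
    by (metis of_int_le_iff of_int_mult of_int_of_nat_eq)
  moreover have "odd_round k x = real_of_int (j * (if x > 0 then 1 else if x < 0 then - 1 else 0)) / real k"
    by (simp add: odd_round_def j_def sgn_if)
  ultimately show ?thesis
    by (intro image_eqI[where x = "j * (if x > 0 then 1 else if x < 0 then - 1 else 0)"]) auto
qed

lemma odd_round_tendsto: "(\<lambda>k. odd_round k x) \<longlonglongrightarrow> x"
proof -
  have "\<forall>\<^sub>F k in sequentially. norm (odd_round k x - x) \<le> 1 / real k"
    using eventually_ge_at_top[of "max 1 (nat \<lceil>\<bar>x\<bar>\<rceil>)"]
  proof eventually_elim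
    case (elim k)
    then have k: "real k \<ge> 1" "\<bar>x\<bar> \<le> real k" by (auto simp: nat_le_iff ceiling_le_iff)
    define d where "d = real_of_int \<lfloor>\<bar>x\<bar> * real k\<rfloor> / real k"
    have "\<bar>x\<bar> * real k - 1 \<le> real_of_int \<lfloor>\<bar>x\<bar> * real k\<rfloor>" "real_of_int \<lfloor>\<bar>x\<bar> * real k\<rfloor> \<le> \<bar>x\<bar> * real k"
      by linarith+
    then have "(\<bar>x\<bar> * real k - 1) / real k \<le> d" "d \<le> \<bar>x\<bar> * real k / real k"
      unfolding d_def by (intro divide_right_mono; simp)+
    then have d: "\<bar>x\<bar> - 1 / real k \<le> d" "d \<le> \<bar>x\<bar>"
      using k(1) by (auto simp: diff_divide_distrib)
    have "odd_round k x - x = sgn x * (d - \<bar>x\<bar>)"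
      using k(2) by (simp add: odd_round_def d_def right_diff_distrib sgn_mult_abs min_absorb1)
    then have "norm (odd_round k x - x) \<le> \<bar>d - \<bar>x\<bar>\<bar>"
      by (simp add: abs_mult abs_sgn_eq)
    then show ?case using d by simp
  qed
  then have "(\<lambda>k. odd_round k x - x) \<longlonglongrightarrow> 0"
    by (rule Lim_null_comparison) (rule lim_1_over_n)
  then show ?thesis by (simp add: LIM_zero_iff)
qed

text \<open>Each term is replaced by the largest one. The crude factor is harmless, as the bound
  only supplies an integrable majorant.\<close>

lemma powr_sum_abs_le:
  fixes x :: "nat \<Rightarrow> real"
  assumes "p > 0"
  shows "(\<Sum>i<n. \<bar>x i\<bar>) powr p \<le> real n powr p * (\<Sum>i<n. \<bar>x i\<bar> powr p)"
proof (cases "n = 0")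
  case False
  define m where "m = Max ((\<lambda>i. \<bar>x i\<bar>) ` {..<n})"
  have "m \<in> (\<lambda>i. \<bar>x i\<bar>) ` {..<n}"
    unfolding m_def using False by (intro Max_in) auto
  then obtain i where i: "i < n" "m = \<bar>x i\<bar>" by auto
  have "\<bar>x j\<bar> \<le> m" if "j < n" for j
    unfolding m_def using that by (intro Max_ge) auto
  then have "(\<Sum>i<n. \<bar>x i\<bar>) \<le> real n * m"
    using sum_bounded_above[of "{..<n}" "\<lambda>i. \<bar>x i\<bar>" m] by simp
  then have "(\<Sum>i<n. \<bar>x i\<bar>) powr p \<le> (real n * m) powr p"
    using assms by (intro powr_mono2) (auto intro: sum_nonneg)
  also have "\<dots> = real n powr p * m powr p"
    using i by (simp add: powr_mult)
  also have "m powr p \<le> (\<Sum>i<n. \<bar>x i\<bar> powr p)"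
    unfolding i(2) using i(1) by (intro member_le_sum) auto
  finally show ?thesis by (simp add: mult_left_mono)
qed simp

lemma abs_powr_two: "\<bar>x::real\<bar> powr 2 = x\<^sup>2"
  by (cases "x = 0") (auto simp: powr_numeral)

lemma power2_le_abs_powr:
  fixes x p :: real
  assumes "p \<ge> 2"
  shows "x\<^sup>2 \<le> 1 + \<bar>x\<bar> powr p"
proof (cases "\<bar>x\<bar> \<le> 1")
  case True
  then have "x\<^sup>2 \<le> 1" by (simp add: abs_square_le_1)
  then show ?thesis using powr_ge_zero[of "\<bar>x\<bar>" p] by linarith
next
  case False
  then have "\<bar>x\<bar> powr 2 \<le> \<bar>x\<bar> powr p" using assms by (intro powr_mono) auto
  then show ?thesis by (simp add: abs_powr_two)
qed

context prob_space
begin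

lemma integrable_power2_of_abs_powr:
  fixes p :: real
  assumes "p \<ge> 2" and [measurable]: "random_variable borel X" and "integrable M (\<lambda>\<omega>. \<bar>X \<omega>\<bar> powr p)"
  shows "integrable M (\<lambda>\<omega>. (X \<omega>)\<^sup>2)"
proof (rule Bochner_Integration.integrable_bound[of M "\<lambda>\<omega>. 1 + \<bar>X \<omega>\<bar> powr p"])
  show "integrable M (\<lambda>\<omega>. 1 + \<bar>X \<omega>\<bar> powr p)"
    using assms(3) by simp
  show "AE \<omega> in M. norm ((X \<omega>)\<^sup>2) \<le> norm (1 + \<bar>X \<omega>\<bar> powr p)"
    by (rule AE_I2) (use power2_le_abs_powr[OF assms(1)] in simp)
qed measurable

text \<open>The bound holds for the rounded variables at every level \<open>k\<close>, and dominated
  convergence passes it to the limit.\<close>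

lemma rosenthal_normalized:
  fixes X :: "nat \<Rightarrow> 'a \<Rightarrow> real"
  assumes p: "p > 4" and indep: "indep_vars (\<lambda>_. borel) X UNIV"
    and sym: "\<And>i. symmetrically_distributed M (X i)"
    and int: "\<And>i. integrable M (\<lambda>\<omega>. \<bar>X i \<omega>\<bar> powr p)"
    and second: "(\<Sum>i<n. expectation (\<lambda>\<omega>. (X i \<omega>)\<^sup>2)) \<le> 1"
    and pth: "(\<Sum>i<n. expectation (\<lambda>\<omega>. \<bar>X i \<omega>\<bar> powr p)) \<le> 1"
  shows "expectation (\<lambda>\<omega>. \<bar>\<Sum>i<n. X i \<omega>\<bar> powr p) \<le> sym_poisson_moment p"
proof -
  have rv [measurable]: "random_variable borel (X i)" for i
    using indep by (auto simp: indep_vars_def)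
  have int2: "integrable M (\<lambda>\<omega>. (X i \<omega>)\<^sup>2)" for i
    using p int by (intro integrable_power2_of_abs_powr[of p]) auto
  have round_p: "\<bar>odd_round k x\<bar> powr p \<le> \<bar>x\<bar> powr p" for k x
    using p abs_odd_round_le by (intro powr_mono2) auto
  have round_2: "(odd_round k x)\<^sup>2 \<le> x\<^sup>2" for k x
    using abs_odd_round_le[of k x] by (simp add: abs_le_square_iff)
  have bound: "expectation (\<lambda>\<omega>. \<bar>\<Sum>i<n. odd_round k (X i \<omega>)\<bar> powr p) \<le> sym_poisson_moment p" for k
  proof (rule rosenthal_finite_range[OF p, where F = "\<lambda>_. (\<lambda>j. real_of_int j / real k) ` {- (int k * int k)..int k * int k}"])
    show "indep_vars (\<lambda>_. borel) (\<lambda>i \<omega>. odd_round k (X i \<omega>)) UNIV"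
      using indep by (rule indep_vars_compose2) auto
    show "symmetrically_distributed M (\<lambda>\<omega>. odd_round k (X i \<omega>))" for i
      using sym by (rule symmetrically_distributed_compose) (auto simp: odd_round_minus)
    have "(\<Sum>i<n. expectation (\<lambda>\<omega>. (odd_round k (X i \<omega>))\<^sup>2)) \<le> (\<Sum>i<n. expectation (\<lambda>\<omega>. (X i \<omega>)\<^sup>2))"
      using round_2 by (intro sum_mono integral_mono' int2) auto
    then show "(\<Sum>i<n. expectation (\<lambda>\<omega>. (odd_round k (X i \<omega>))\<^sup>2)) \<le> 1"
      using second by simp
    have "(\<Sum>i<n. expectation (\<lambda>\<omega>. \<bar>odd_round k (X i \<omega>)\<bar> powr p)) \<le> (\<Sum>i<n. expectation (\<lambda>\<omega>. \<bar>X i \<omega>\<bar> powr p))"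
      using round_p by (intro sum_mono integral_mono' int) auto
    then show "(\<Sum>i<n. expectation (\<lambda>\<omega>. \<bar>odd_round k (X i \<omega>)\<bar> powr p)) \<le> 1"
      using pth by simp
  qed (auto simp: odd_round_in_grid)
  have "(\<lambda>k. expectation (\<lambda>\<omega>. \<bar>\<Sum>i<n. odd_round k (X i \<omega>)\<bar> powr p))
      \<longlonglongrightarrow> expectation (\<lambda>\<omega>. \<bar>\<Sum>i<n. X i \<omega>\<bar> powr p)"
  proof (rule integral_dominated_convergence[where w = "\<lambda>\<omega>. real n powr p * (\<Sum>i<n. \<bar>X i \<omega>\<bar> powr p)"])
    show "integrable M (\<lambda>\<omega>. real n powr p * (\<Sum>i<n. \<bar>X i \<omega>\<bar> powr p))"
      using int by auto
    show "AE \<omega> in M. (\<lambda>k. \<bar>\<Sum>i<n. odd_round k (X i \<omega>)\<bar> powr p) \<longlonglongrightarrow> \<bar>\<Sum>i<n. X i \<omega>\<bar> powr p"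
      using p by (intro AE_I2 tendsto_powr' tendsto_rabs tendsto_sum odd_round_tendsto tendsto_const) auto
    show "AE \<omega> in M. norm (\<bar>\<Sum>i<n. odd_round k (X i \<omega>)\<bar> powr p) \<le> real n powr p * (\<Sum>i<n. \<bar>X i \<omega>\<bar> powr p)" for k
    proof (rule AE_I2)
      fix \<omega>
      have "\<bar>\<Sum>i<n. odd_round k (X i \<omega>)\<bar> \<le> (\<Sum>i<n. \<bar>odd_round k (X i \<omega>)\<bar>)"
        by (rule sum_abs)
      also have "\<dots> \<le> (\<Sum>i<n. \<bar>X i \<omega>\<bar>)"
        by (intro sum_mono abs_odd_round_le)
      finally have "\<bar>\<Sum>i<n. odd_round k (X i \<omega>)\<bar> powr p \<le> (\<Sum>i<n. \<bar>X i \<omega>\<bar>) powr p"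
        using p by (intro powr_mono2) auto
      also have "\<dots> \<le> real n powr p * (\<Sum>i<n. \<bar>X i \<omega>\<bar> powr p)"
        using p by (intro powr_sum_abs_le) auto
      finally show "norm (\<bar>\<Sum>i<n. odd_round k (X i \<omega>)\<bar> powr p) \<le> real n powr p * (\<Sum>i<n. \<bar>X i \<omega>\<bar> powr p)"
        by simp
    qed
  qed measurable
  then show ?thesis
    by (rule LIMSEQ_le_const2) (use bound in blast)
qed

text \<open>Symmetry makes the means 0, so independence removes the cross terms. This turns the
  \<open>L2\<close> norm in the denominator into a constraint on the sum of second moments.\<close>

lemma expectation_sum_squared:
  fixes X :: "nat \<Rightarrow> 'a \<Rightarrow> real"
  assumes indep: "indep_vars (\<lambda>_. borel) X UNIV"
    and sym: "\<And>i. symmetrically_distributed M (X i)"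
    and int2: "\<And>i. integrable M (\<lambda>\<omega>. (X i \<omega>)\<^sup>2)"
  shows "integrable M (\<lambda>\<omega>. (\<Sum>i<n. X i \<omega>)\<^sup>2) \<and>
    expectation (\<lambda>\<omega>. (\<Sum>i<n. X i \<omega>)\<^sup>2) = (\<Sum>i<n. expectation (\<lambda>\<omega>. (X i \<omega>)\<^sup>2))"
proof (induction n)
  case 0
  then show ?case by simp
next
  case (Suc n)
  have rv [measurable]: "random_variable borel (X i)" for i
    using indep by (auto simp: indep_vars_def)
  let ?S = "\<lambda>\<omega>. \<Sum>i<n. X i \<omega>"
  have int1: "integrable M (X i)" for i
    using square_integrable_imp_integrable[OF rv int2] .
  have iv: "indep_var borel (X n) borel ?S"
    by (rule indep_vars_sum) (auto intro: indep_vars_subset[OF indep])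
  have intS: "integrable M ?S"
    using int1 by auto
  have "expectation (X n) = 0"
    using symmetrically_distributed_integral[OF sym rv, of "\<lambda>x. x" n] by simp
  then have cross: "integrable M (\<lambda>\<omega>. X n \<omega> * ?S \<omega>)" "expectation (\<lambda>\<omega>. X n \<omega> * ?S \<omega>) = 0"
    using indep_var_integrable[OF iv int1 intS] indep_var_lebesgue_integral[OF iv int1 intS] by auto
  have "(\<Sum>i<Suc n. X i \<omega>)\<^sup>2 = (?S \<omega>)\<^sup>2 + 2 * (X n \<omega> * ?S \<omega>) + (X n \<omega>)\<^sup>2" for \<omega>
    by (simp add: power2_eq_square algebra_simps)
  then show ?case
    using Suc cross int2 by simp
qed

end

section \<open>Upper bound, extremal sequences and the value of the constant\<close>

text \<open>The ratio is homogeneous of degree 0. After division by the denominator \<open>d\<close>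
  both moment sums are at most 1 and the normalised inequality applies.\<close>

lemma rosenthal_ratio_le:
  assumes p: "p > 4" and adm: "admissible_sequence p M X" and denom: "rosenthal_denom p M X n \<noteq> 0"
  shows "rosenthal_ratio p M X n \<le> sym_poisson_moment p powr (1 / p)"
proof -
  interpret prob_space M using adm by (simp add: admissible_sequence_def)
  have indep: "indep_vars (\<lambda>_. borel) X UNIV" and sym: "\<And>i. symmetrically_distributed M (X i)"
    and int: "\<And>i. integrable M (\<lambda>\<omega>. \<bar>X i \<omega>\<bar> powr p)"
    using adm by (auto simp: admissible_sequence_def)
  have rv [measurable]: "random_variable borel (X i)" for i
    using indep by (auto simp: indep_vars_def)
  have int2: "integrable M (\<lambda>\<omega>. (X i \<omega>)\<^sup>2)" for i
    using p int by (intro integrable_power2_of_abs_powr[of p]) auto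
  define d where "d = rosenthal_denom p M X n"
  have "d \<ge> 0" by (simp add: d_def rosenthal_denom_def Lp_norm_def le_max_iff_disj)
  then have d: "d > 0" using denom by (simp add: d_def)
  have root_le: "x \<le> d powr q" if "x powr (1 / q) \<le> d" "q > 0" "x \<ge> 0" for x q
  proof -
    have "(x powr (1 / q)) powr q \<le> d powr q"
      using that by (intro powr_mono2) auto
    then show ?thesis using that by (simp add: powr_powr)
  qed
  have "Lp_norm M 2 (\<lambda>\<omega>. \<Sum>i<n. X i \<omega>) \<le> d"
    by (simp add: d_def rosenthal_denom_def)
  then have "expectation (\<lambda>\<omega>. (\<Sum>i<n. X i \<omega>)\<^sup>2) \<le> d powr 2"
    by (intro root_le) (auto simp: Lp_norm_def abs_powr_two)
  then have second: "(\<Sum>i<n. expectation (\<lambda>\<omega>. (X i \<omega>)\<^sup>2)) \<le> d\<^sup>2"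
    using expectation_sum_squared[OF indep sym int2] d by (simp add: powr_numeral)
  have "(\<Sum>i<n. Lp_norm M p (X i) powr p) powr (1 / p) \<le> d"
    by (simp add: d_def rosenthal_denom_def)
  moreover have "Lp_norm M p (X i) powr p = expectation (\<lambda>\<omega>. \<bar>X i \<omega>\<bar> powr p)" for i
    using p by (simp add: Lp_norm_def powr_powr)
  ultimately have pth: "(\<Sum>i<n. expectation (\<lambda>\<omega>. \<bar>X i \<omega>\<bar> powr p)) \<le> d powr p"
    using p by (intro root_le) (auto intro: sum_nonneg)
  have scale: "\<bar>x / d\<bar> powr p = \<bar>x\<bar> powr p / d powr p" for x
    using d by (simp add: powr_divide)
  have "expectation (\<lambda>\<omega>. \<bar>\<Sum>i<n. X i \<omega> / d\<bar> powr p) \<le> sym_poisson_moment p"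
  proof (rule rosenthal_normalized[OF p])
    show "indep_vars (\<lambda>_. borel) (\<lambda>i \<omega>. X i \<omega> / d) UNIV"
      using indep by (rule indep_vars_compose2) auto
    show "symmetrically_distributed M (\<lambda>\<omega>. X i \<omega> / d)" for i
      using sym by (rule symmetrically_distributed_compose) auto
    show "integrable M (\<lambda>\<omega>. \<bar>X i \<omega> / d\<bar> powr p)" for i
      unfolding scale using int by auto
    show "(\<Sum>i<n. expectation (\<lambda>\<omega>. (X i \<omega> / d)\<^sup>2)) \<le> 1"
      using second d by (simp add: power_divide sum_divide_distrib[symmetric])
    show "(\<Sum>i<n. expectation (\<lambda>\<omega>. \<bar>X i \<omega> / d\<bar> powr p)) \<le> 1"
      unfolding scale using pth d by (simp add: sum_divide_distrib[symmetric])
  qed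
  then have "expectation (\<lambda>\<omega>. \<bar>\<Sum>i<n. X i \<omega>\<bar> powr p) / d powr p \<le> sym_poisson_moment p"
    by (simp only: sum_divide_distrib[symmetric] scale) simp
  then have "(expectation (\<lambda>\<omega>. \<bar>\<Sum>i<n. X i \<omega>\<bar> powr p) / d powr p) powr (1 / p) \<le> sym_poisson_moment p powr (1 / p)"
    using p by (intro powr_mono2) auto
  also have "(expectation (\<lambda>\<omega>. \<bar>\<Sum>i<n. X i \<omega>\<bar> powr p) / d powr p) powr (1 / p) = rosenthal_ratio p M X n"
    using p d by (simp add: rosenthal_ratio_def d_def[symmetric] Lp_norm_def powr_divide powr_powr)
  finally show ?thesis .
qed

text \<open>The extremal sequences: \<open>m\<close> independent variables equal to \<open>\<plusminus>1\<close> with probability \<open>1/(2m)\<close> each,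
  and \<open>0\<close> otherwise.\<close>

lemma rosenthal_ratio_lazy_walk:
  assumes p: "p > 4" and m: "m \<ge> 1"
  shows "((lazy_op (1 / real m) (avg_shift 1) ^^ m) (\<lambda>x. \<bar>x\<bar> powr p) 0) powr (1 / p) \<in> rosenthal_ratios p"
proof -
  define s where "s = 1 / real m"
  have s: "0 \<le> s" "s \<le> 1" "real m * s = 1" using m by (auto simp: s_def)
  define v where "v = (\<lambda>x::real. if x = 0 then 1 - s else if x = 1 \<or> x = -1 then s / 2 else 0)"
  define F where "F = {-1, 0, 1::real}"
  define q where "q = embed_pmf v"
  have "(\<integral>\<^sup>+x. ennreal (v x) \<partial>count_space UNIV) = (\<Sum>x\<in>F. ennreal (v x))"
    by (rule nn_integral_count_space') (auto simp: F_def v_def split: if_splits)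
  also have "\<dots> = ennreal (\<Sum>x\<in>F. v x)"
    by (rule sum_ennreal) (use s in \<open>auto simp: v_def\<close>)
  also have "(\<Sum>x\<in>F. v x) = 1"
    by (simp add: F_def v_def)
  finally have pmf_q: "pmf q x = v x" for x
    unfolding q_def using s by (intro pmf_embed_pmf) (auto simp: v_def)
  have "map_pmf uminus q = q"
  proof (rule pmf_eqI)
    fix x :: real
    have "pmf (map_pmf uminus q) (- (- x)) = pmf q (- x)"
      by (rule pmf_map_inj') (auto simp: inj_def)
    then show "pmf (map_pmf uminus q) x = pmf q x"
      by (auto simp: pmf_q v_def)
  qed
  \<comment> \<open>The discrete law is moved to the Borel sigma-algebra, because equality of
    \<open>D\<close> with the law of a coordinate also compares sigma-algebras.\<close>
  define D where "D = distr (measure_pmf q) borel (\<lambda>x. x)"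
  have D_uminus: "distr D borel uminus = D"
  proof -
    have "distr D borel uminus = distr (measure_pmf q) borel uminus"
      unfolding D_def by (subst distr_distr) (auto simp: comp_def)
    also have "\<dots> = distr (distr (measure_pmf q) (count_space UNIV) uminus) borel (\<lambda>x. x)"
      by (subst distr_distr) (auto simp: comp_def)
    also have "distr (measure_pmf q) (count_space UNIV) uminus = measure_pmf q"
      using \<open>map_pmf uminus q = q\<close> by (metis map_pmf_rep_eq)
    finally show ?thesis by (simp add: D_def)
  qed
  have sets_D [measurable_cong]: "sets D = sets borel" and space_D: "space D = UNIV"
    by (auto simp: D_def)
  interpret D: prob_space D
    unfolding D_def by (rule prob_space.prob_space_distr[OF prob_space_measure_pmf]) simp
  \<comment> \<open>The countable product of copies of \<open>D\<close> makes the coordinates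
    independent and lives on the sample type that \<open>rosenthal_ratios\<close>
    prescribes.\<close>
  define M where "M = (\<Pi>\<^sub>M i\<in>(UNIV :: nat set). D)"
  define X where "X = (\<lambda>i (\<omega> :: nat \<Rightarrow> real). \<omega> i)"
  interpret product_prob_space "\<lambda>_. D" "UNIV :: nat set"
    by unfold_locales
  interpret M: prob_space M
    unfolding M_def by (rule prob_space_PiM) (rule D.prob_space_axioms)
  have sets_M: "sets M = sets (\<Pi>\<^sub>M i\<in>(UNIV :: nat set). (borel :: real measure))"
    unfolding M_def by (rule sets_PiM_cong) (auto simp: sets_D)
  have X [measurable]: "X i \<in> borel_measurable M" for i
    unfolding X_def measurable_cong_sets[OF sets_M refl] by (rule measurable_component_singleton) simp
  have distr_X: "distr M borel (X i) = D" for i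
  proof -
    have "distr M borel (X i) = distr M D (X i)"
      by (rule distr_cong) (auto simp: sets_D)
    also have "\<dots> = D"
      unfolding M_def X_def by (rule PiM_component) simp
    finally show ?thesis .
  qed
  have indep: "M.indep_vars (\<lambda>_. borel) X UNIV"
  proof (subst M.indep_vars_iff_distr_eq_PiM)
    have "distr M (\<Pi>\<^sub>M i\<in>UNIV. borel) (\<lambda>x. \<lambda>i\<in>UNIV. X i x) = distr M M (\<lambda>x. x)"
      by (rule distr_cong) (auto simp: sets_M X_def restrict_def)
    also have "\<dots> = M" by (rule distr_id)
    finally show "distr M (\<Pi>\<^sub>M i\<in>UNIV. borel) (\<lambda>x. \<lambda>i\<in>UNIV. X i x) = (\<Pi>\<^sub>M i\<in>UNIV. distr M borel (X i))"
      by (simp only: distr_X M_def[symmetric])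
  qed auto
  have sym: "symmetrically_distributed M (X i)" for i
  proof -
    have "distr M borel (\<lambda>\<omega>. - X i \<omega>) = distr (distr M borel (X i)) borel uminus"
      by (subst distr_distr) (auto simp: comp_def)
    then show ?thesis
      by (simp add: symmetrically_distributed_def distr_X D_uminus)
  qed
  have F: "finite F" "AE \<omega> in M. X i \<omega> \<in> F" for i
  proof -
    have "AE x in D. x \<in> F"
      unfolding D_def by (subst AE_distr_iff) (auto simp: AE_measure_pmf_iff set_pmf_iff pmf_q v_def F_def split: if_splits)
    then have "AE x in distr M borel (X i). x \<in> F"
      by (simp only: distr_X[of i])
    then show "AE \<omega> in M. X i \<omega> \<in> F"
      by (subst (asm) AE_distr_iff) (auto simp: F_def)
  qed (simp add: F_def)
  have point_prob: "M.prob (X i -` {x} \<inter> space M) = v x" for i x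
  proof -
    have "M.prob (X i -` {x} \<inter> space M) = measure (distr M borel (X i)) {x}"
      by (subst measure_distr) auto
    also have "\<dots> = measure (measure_pmf q) {x}"
      unfolding distr_X D_def by (subst measure_distr) auto
    finally show ?thesis by (simp add: measure_pmf_single pmf_q)
  qed
  have moment: "M.expectation (\<lambda>\<omega>. g (X i \<omega>)) = (\<Sum>x\<in>F. v x * g x)"
    if "g \<in> borel_measurable borel" for g :: "real \<Rightarrow> real" and i
    using M.expectation_finite_range[OF X that F] by (simp add: point_prob)
  have sum_moment: "M.expectation (\<lambda>\<omega>. f (z + (\<Sum>i<n. X i \<omega>))) = op_prod (\<lambda>_. sym_op F v) n f z"
    if "f \<in> borel_measurable borel" for f :: "real \<Rightarrow> real" and n z
    using M.expectation_sum_op_prod[OF indep sym F that, of z n] by (auto simp: point_prob)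
  have int_p: "integrable M (\<lambda>\<omega>. \<bar>X i \<omega>\<bar> powr p)" for i
  proof (rule M.integrable_const_bound[of _ 1])
    show "AE \<omega> in M. norm (\<bar>X i \<omega>\<bar> powr p) \<le> 1"
      using F(2)[of i] by eventually_elim (auto simp: F_def)
  qed simp
  have int_2: "integrable M (\<lambda>\<omega>. (X i \<omega>)\<^sup>2)" for i
    using p int_p by (intro M.integrable_power2_of_abs_powr[of p]) auto
  have adm: "admissible_sequence p M X"
    unfolding admissible_sequence_def using M.prob_space_axioms indep sym int_p by blast
  have op: "sym_op F v = lazy_op s (avg_shift 1)"
    by (intro ext) (simp add: sym_op_def lazy_op_def F_def v_def avg_shift_def field_simps)
  have second: "M.expectation (\<lambda>\<omega>. (X i \<omega>)\<^sup>2) = s" for i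
    using moment[of "\<lambda>x. x\<^sup>2"] by (simp add: F_def v_def)
  have pth: "M.expectation (\<lambda>\<omega>. \<bar>X i \<omega>\<bar> powr p) = s" for i
    using moment[of "\<lambda>x. \<bar>x\<bar> powr p"] by (simp add: F_def v_def)
  \<comment> \<open>Because the values are 0 and \<plusminus>1, second and \<open>p\<close>-th
    moments both equal \<open>s\<close>; with \<open>m * s = 1\<close> the two parts of the
    denominator are both 1.\<close>
  have "M.expectation (\<lambda>\<omega>. (\<Sum>i<m. X i \<omega>)\<^sup>2) = 1"
    using M.expectation_sum_squared[OF indep sym int_2, of m] s(3) by (simp add: second)
  then have "Lp_norm M 2 (\<lambda>\<omega>. \<Sum>i<m. X i \<omega>) = 1"
    by (simp add: Lp_norm_def abs_powr_two)
  moreover have "(\<Sum>i<m. Lp_norm M p (X i) powr p) = 1"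
    using p s by (simp add: Lp_norm_def pth powr_powr)
  ultimately have denom: "rosenthal_denom p M X m = 1"
    by (simp add: rosenthal_denom_def)
  have "Lp_norm M p (\<lambda>\<omega>. \<Sum>i<m. X i \<omega>) = ((lazy_op s (avg_shift 1) ^^ m) (\<lambda>x. \<bar>x\<bar> powr p) 0) powr (1 / p)"
    using sum_moment[of "\<lambda>x. \<bar>x\<bar> powr p" 0 m] by (simp add: Lp_norm_def op op_prod_const)
  then have "rosenthal_ratio p M X m = ((lazy_op s (avg_shift 1) ^^ m) (\<lambda>x. \<bar>x\<bar> powr p) 0) powr (1 / p)"
    by (simp add: rosenthal_ratio_def denom)
  with rosenthal_ratio_in_set[OF adm, of m] denom show ?thesis
    by (simp add: s_def)
qed

text \<open>The universal upper bound on the ratios is the limit of ratios of the lazy walks, so it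
  is the supremum. These facts also show that the set is nonempty and bounded, as the rules for the
  real \<open>Sup\<close> require.\<close>

lemma rosenthal_K_eq:
  assumes p: "p > 4"
  shows "rosenthal_K p = sym_poisson_moment p"
proof -
  define a where "a = (\<lambda>m. (lazy_op (1 / real m) (avg_shift 1) ^^ m) (\<lambda>x. \<bar>x\<bar> powr p) 0)"
  define L where "L = sym_poisson_moment p powr (1 / p)"
  have lim: "a \<longlonglongrightarrow> sym_poisson_moment p"
    unfolding a_def by (rule lazy_walk_moment_tendsto[OF p])
  have a: "a m \<ge> 0" if "m \<ge> 1" for m
  proof -
    have "trans_op (lazy_op (1 / real m) (avg_shift 1) ^^ m)"
      using that by (intro trans_op_funpow trans_op_lazy_op trans_op_avg_shift) auto
    from trans_op_mono[OF this, of "\<lambda>_. 0 * 0" "\<lambda>x. \<bar>x\<bar> powr p" 0] trans_op_cmult[OF this, of 0 "\<lambda>_. 0"]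
    show ?thesis by (simp add: a_def)
  qed
  have nonneg: "sym_poisson_moment p \<ge> 0"
    by (rule LIMSEQ_le_const[OF lim]) (use a in blast)
  have mem: "a m powr (1 / p) \<in> rosenthal_ratios p" if "m \<ge> 1" for m
    unfolding a_def by (rule rosenthal_ratio_lazy_walk[OF p that])
  have upper: "x \<le> L" if "x \<in> rosenthal_ratios p" for x
    using that rosenthal_ratio_le[OF p] unfolding rosenthal_ratios_def L_def by blast
  have "rosenthal_S p = L"
  proof (rule antisym)
    show "rosenthal_S p \<le> L"
      unfolding rosenthal_S_def using mem[of 1] upper by (intro cSup_least) auto
    have "(\<lambda>m. a m powr (1 / p)) \<longlonglongrightarrow> L"
      unfolding L_def using p a
      by (intro tendsto_powr' lim tendsto_const) (auto simp: eventually_sequentially)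
    moreover have "a m powr (1 / p) \<le> rosenthal_S p" if "m \<ge> 1" for m
      unfolding rosenthal_S_def using mem[OF that] upper by (intro cSup_upper bdd_aboveI) auto
    ultimately show "L \<le> rosenthal_S p"
      by (intro LIMSEQ_le_const2) auto
  qed
  then show ?thesis
    using p nonneg by (simp add: rosenthal_K_def L_def powr_powr)
qed

text \<open>The iterated derivatives of \<open>g\<close> serve as the chain of derivatives for
  \<open>f\<close>; openness of \<open>U\<close> enters through
  \<open>infinitely_differentiable_onI\<close>.\<close>

lemma infinitely_differentiable_on_cong:
  assumes "infinitely_differentiable_on g U" "open U" "\<And>x. x \<in> U \<Longrightarrow> f x = g x"
  shows "infinitely_differentiable_on f U"
proof (rule infinitely_differentiable_onI[where F = "\<lambda>j. (deriv ^^ j) g", OF assms(2)])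
  fix j x assume "x \<in> U"
  then have "(deriv ^^ j) g field_differentiable at x"
    using assms(1) by (simp add: infinitely_differentiable_on_def)
  then show "((deriv ^^ j) g has_real_derivative (deriv ^^ Suc j) g x) (at x)"
    by (simp add: field_differentiable_derivI)
qed (use assms(3) in simp)

theorem mainTheorem10:
  shows "infinitely_differentiable_on poisson_L {4<..} \<and>
         infinitely_differentiable_on rosenthal_K {4<..}"
  using infinitely_differentiable_poisson_L
    infinitely_differentiable_on_cong[OF infinitely_differentiable_sym_poisson_moment, of rosenthal_K]
  by (simp add: rosenthal_K_eq)

end
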